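(* Let $M$ be a countable transitive model of ZFC and $\mathbb{P}\in M$ a forcing poset; let $\mathbb{B}$ be the complete Boolean algebra of regular open subsets of $\mathbb{P}$ and $i:\mathbb{P}\to\mathbb{B}\setminus\{0\}$ the canonical dense morphism. Let $r:M^{\mathbb{B}\setminus\{0\}}\to M^{\mathbb{B}}_{fun}$ be the retraction defined below. Then for every formula $\phi(x_1,\dots,x_n)$ of the forcing language, all $\mathbb{P}$-names $\dot x_1,\dots,\dot x_n$ and all $p\in\mathbb{P}$, $$p\Vdash^*\phi(\dot x_1,\dots,\dot x_n)\iff p\Vdash\phi(r(i_*(\dot x_1)),\dots,r(i_*(\dot x_n))),$$ where $\Vdash^*$ is the forcing relation of $\mathbb{P}$ and $p\Vdash\psi$ means $i(p)\le\|\psi\|$.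
   Context: A forcing poset is a nonempty set with a preorder $\le$ and top element $\mathbb{1}$. Give $\mathbb{P}$ the topology generated by the sets $\overleftarrow{p}=\{q:q\le p\}$; $\mathbb{B}$ is its complete Boolean algebra of regular open sets (order $\subseteq$, $0=\emptyset$, $1=\mathbb{P}$), and $i(p)=int(cl(\overleftarrow{p}))$. $\mathbb{B}\setminus\{0\}$ is a forcing poset with the Boolean order. For a forcing poset $\mathbb{Q}$, a $\mathbb{Q}$-name is (recursively) a relation of pairs $(\dot y,q)$ with $\dot y$ a $\mathbb{Q}$-name, $q\in\mathbb{Q}$; $M^{\mathbb{Q}}$ is the class of these in $M$. A name is functional if it is a function and every name in its domain is functional; $M^{\mathbb{B}}_{fun}$ is the class of functional $(\mathbb{B}\setminus\{0\})$-names, each of which is an element of the Boolean-valued universe $V^{\mathbb{B}}$ built in $M$ ($V^{\mathbb{B}}_0=\emptyset$, $V^{\mathbb{B}}_{\alpha+1}$ = functions with domain $\subseteq V^{\mathbb{B}}_\alpha$ and values in $\mathbb{B}$, unions at limits). $i_*(\dot x)=\{(i_*(\dot y),i(q)):(\dot y,q)\in\dot x\}$. $r(\dot x)=\{(r(\dot y),\bigvee\{p:(\dot z,p)\in\dot x,\ r(\dot z)=r(\dot y)\}):\dot y\in dom(\dot x)\}$. Boolean values on $V^{\mathbb{B}}$: $\|x\in y\|=\bigvee_{t\in dom(y)}(\|x=t\|\cdot y(t))$, $\|x\subseteq y\|=\bigwedge_{t\in dom(x)}(-x(t)+\|t\in y\|)$, $\|x=y\|=\|x\subseteq y\|\cdot\|y\subseteq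 x\|$, $\|\neg\phi\|=-\|\phi\|$, $\|\phi\wedge\psi\|=\|\phi\|\cdot\|\psi\|$, $\|\phi\vee\psi\|=\|\phi\|+\|\psi\|$, $\|\phi\to\psi\|=\|\neg\phi\vee\psi\|$, $\|\phi\leftrightarrow\psi\|=\|(\phi\to\psi)\wedge(\psi\to\phi)\|$, $\|\exists x\phi\|=\bigvee_{x\in V^{\mathbb{B}}}\|\phi(x)\|$, $\|\forall x\phi\|=\bigwedge_{x\in V^{\mathbb{B}}}\|\phi(x)\|$. The forcing relation $\Vdash^*$ of $\mathbb{P}$ ("dense below $p$" means every $q\le p$ has an element of the set below it): $p\Vdash^*\dot x=\dot y$ iff for all $\dot z\in dom(\dot x)\cup dom(\dot y)$ and $q\le p$, $q\Vdash^*\dot z\in\dot x$ iff $q\Vdash^*\dot z\in\dot y$; $p\Vdash^*\dot x\in\dot y$ iff $\{q\le p:\exists(\dot z,r)\in\dot y\,(q\le r\wedge q\Vdash^*\dot x=\dot z)\}$ is dense below $p$; $p\Vdash^*\phi\wedge\psi$ iff both; $p\Vdash^*\neg\phi$ iff no $q\le p$ forces $\phi$; $p\Vdash^*\phi\to\psi$ iff no $q\le p$ forces $\phi\wedge\neg\psi$; $p\Vdash^*\phi\vee\psi$ iff $\{q:q\Vdash^*\phi\text{ or }q\Vdash^*\psi\}$ is dense below $p$; $p\Vdash^*\phi\leftrightarrow\psi$ iff no $q\le p$ forces $\phi\wedge\neg\psi$ and no $r\le p$ forces $\neg\phi\wedge\psi$; $p\Vdash^*\forall x\phi(x)$ iff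 $p\Vdash^*\phi(\dot x)$ for every name $\dot x$; $p\Vdash^*\exists x\phi(x)$ iff $\{q:\exists\dot x\,(q\Vdash^*\phi(\dot x))\}$ is dense below $p$. *)

theory Defs
  imports "HOL-Analysis.Abstract_Topology" "HOL-Library.Countable_Set_Type" "HOL-Library.Multiset"
begin

section \<open>Hereditarily countable sets\<close>

text \<open>
  Every countable transitive set is a set of hereditarily countable sets.  Hence the countable
  transitive models are exactly the countable transitive subsets of the following type, on which
  \<open>x \<in> elts y\<close> is the real membership relation.
\<close>

datatype hc = HC "hc cset"

primrec elts :: "hc \<Rightarrow> hc set" where
  "elts (HC A) = rcset A"

text \<open>Inverse of \<open>elts\<close>; meaningful for countable arguments only.\<close>

definition mk :: "hc set \<Rightarrow> hc" where
  "mk A = HC (acset A)"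

lemma countable_elts [simp]: "countable (elts x)"
  by (cases x) simp

lemma elts_mk [simp]: "countable A \<Longrightarrow> elts (mk A) = A"
  by (simp add: mk_def)

lemma elts_inject: "elts x = elts y \<longleftrightarrow> x = y"
  by (cases x; cases y) (simp add: rcset_inject)

definition mem_rel :: "(hc \<times> hc) set" where
  "mem_rel = {(x, y). x \<in> elts y}"

lemma mem_rel_iff: "(x, y) \<in> mem_rel \<longleftrightarrow> x \<in> elts y"
  by (simp add: mem_rel_def)

lemma wf_mem_rel: "wf mem_rel"
proof (unfold wf_def, intro allI impI)
  fix Q :: "hc \<Rightarrow> bool" and x
  assume step: "\<forall>x. (\<forall>y. (y, x) \<in> mem_rel \<longrightarrow> Q y) \<longrightarrow> Q x"
  show "Q x"
  proof (induction x)
    case (HC A)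
    have "Q y" if "(y, HC A) \<in> mem_rel" for y
      using that HC by (auto simp: mem_rel_def)
    with step show ?case by blast
  qed
qed

lemma wf_mem_trancl: "wf (mem_rel\<^sup>+)"
  by (rule wf_trancl[OF wf_mem_rel])

definition opair :: "hc \<Rightarrow> hc \<Rightarrow> hc" where
  "opair x y = mk {mk {x}, mk {x, y}}"

lemma opair_inject [simp]: "opair x y = opair x' y' \<longleftrightarrow> x = x' \<and> y = y'"
proof
  assume "opair x y = opair x' y'"
  then have "{mk {x}, mk {x, y}} = {mk {x'}, mk {x', y'}}"
    unfolding opair_def by (metis countable_finite elts_mk finite.emptyI finite.insertI)
  then have "{{x}, {x, y}} = {{x'}, {x', y'}}"
    by (drule_tac arg_cong[where f = "\<lambda>S. elts ` S"]) simp
  then show "x = x' \<and> y = y'"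
    by (auto simp: doubleton_eq_iff)
qed simp

definition vdom :: "hc \<Rightarrow> hc set" where
  "vdom x = {y. \<exists>z. opair y z \<in> elts x}"

definition vran :: "hc \<Rightarrow> hc set" where
  "vran x = {z. \<exists>y. opair y z \<in> elts x}"

definition is_fun :: "hc \<Rightarrow> bool" where
  "is_fun f \<longleftrightarrow> (\<forall>w\<in>elts f. \<exists>x y. w = opair x y) \<and>
     (\<forall>x y z. opair x y \<in> elts f \<and> opair x z \<in> elts f \<longrightarrow> y = z)"

definition app :: "hc \<Rightarrow> hc \<Rightarrow> hc" where
  "app f x = (THE y. opair x y \<in> elts f)"

lemma vdom_mem: "y \<in> vdom x \<Longrightarrow> (y, x) \<in> mem_rel\<^sup>+"
proof -
  assume "y \<in> vdom x"
  then obtain z where z: "opair y z \<in> elts x" by (auto simp: vdom_def)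
  have "y \<in> elts (mk {y})" "mk {y} \<in> elts (opair y z)" by (simp_all add: opair_def)
  with z have "(y, mk {y}) \<in> mem_rel" "(mk {y}, opair y z) \<in> mem_rel" "(opair y z, x) \<in> mem_rel"
    by (auto simp: mem_rel_def)
  then show ?thesis by (blast intro: trancl.r_into_trancl trancl_into_trancl)
qed

definition vsucc :: "hc \<Rightarrow> hc" where
  "vsucc \<beta> = mk (insert \<beta> (elts \<beta>))"

definition is_ord :: "hc \<Rightarrow> bool" where
  "is_ord \<alpha> \<longleftrightarrow> (\<forall>x\<in>elts \<alpha>. elts x \<subseteq> elts \<alpha>) \<and>
     (\<forall>x\<in>elts \<alpha>. \<forall>y\<in>elts x. elts y \<subseteq> elts x)"

lemma mem_vsucc: "\<beta> \<in> elts (vsucc \<beta>)"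
  by (simp add: vsucc_def)

lemma vsucc_inject [simp]: "vsucc \<beta> = vsucc \<gamma> \<longleftrightarrow> \<beta> = \<gamma>"
proof
  assume "vsucc \<beta> = vsucc \<gamma>"
  then have "insert \<beta> (elts \<beta>) = insert \<gamma> (elts \<gamma>)"
    unfolding vsucc_def by (metis countable_elts countable_insert elts_mk)
  then have "\<beta> = \<gamma> \<or> (\<beta> \<in> elts \<gamma> \<and> \<gamma> \<in> elts \<beta>)"
    by (metis insert_iff)
  moreover have "\<not> (\<beta> \<in> elts \<gamma> \<and> \<gamma> \<in> elts \<beta>)"
    using wf_asym[OF wf_mem_rel] by (metis mem_rel_iff)
  ultimately show "\<beta> = \<gamma>" by simp
qed simp


section \<open>Formulas and countable transitive models of ZFC\<close>

text \<open>
  Formulas in the language of set theory with named variables.  Elements of a model, or names,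
  enter a formula through the assignment of its free variables.
\<close>

datatype fm =
    Mem nat nat
  | Eq nat nat
  | Neg fm
  | And fm fm
  | Or fm fm
  | Imp fm fm
  | Iff fm fm
  | All nat fm
  | Ex nat fm

primrec fv :: "fm \<Rightarrow> nat set" where
  "fv (Mem k l) = {k, l}"
| "fv (Eq k l) = {k, l}"
| "fv (Neg \<phi>) = fv \<phi>"
| "fv (And \<phi> \<psi>) = fv \<phi> \<union> fv \<psi>"
| "fv (Or \<phi> \<psi>) = fv \<phi> \<union> fv \<psi>"
| "fv (Imp \<phi> \<psi>) = fv \<phi> \<union> fv \<psi>"
| "fv (Iff \<phi> \<psi>) = fv \<phi> \<union> fv \<psi>"
| "fv (All k \<phi>) = fv \<phi> - {k}"
| "fv (Ex k \<phi>) = fv \<phi> - {k}"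

primrec sat :: "hc set \<Rightarrow> fm \<Rightarrow> (nat \<Rightarrow> hc) \<Rightarrow> bool" where
  "sat M (Mem k l) \<rho> \<longleftrightarrow> \<rho> k \<in> elts (\<rho> l)"
| "sat M (Eq k l) \<rho> \<longleftrightarrow> \<rho> k = \<rho> l"
| "sat M (Neg \<phi>) \<rho> \<longleftrightarrow> \<not> sat M \<phi> \<rho>"
| "sat M (And \<phi> \<psi>) \<rho> \<longleftrightarrow> sat M \<phi> \<rho> \<and> sat M \<psi> \<rho>"
| "sat M (Or \<phi> \<psi>) \<rho> \<longleftrightarrow> sat M \<phi> \<rho> \<or> sat M \<psi> \<rho>"
| "sat M (Imp \<phi> \<psi>) \<rho> \<longleftrightarrow> (sat M \<phi> \<rho> \<longrightarrow> sat M \<psi> \<rho>)"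
| "sat M (Iff \<phi> \<psi>) \<rho> \<longleftrightarrow> (sat M \<phi> \<rho> \<longleftrightarrow> sat M \<psi> \<rho>)"
| "sat M (All k \<phi>) \<rho> \<longleftrightarrow> (\<forall>x\<in>M. sat M \<phi> (\<rho>(k := x)))"
| "sat M (Ex k \<phi>) \<rho> \<longleftrightarrow> (\<exists>x\<in>M. sat M \<phi> (\<rho>(k := x)))"

text \<open>
  The ZFC axioms, relativized to \<open>M\<close>.  In the two schemes the values of \<open>\<rho>\<close> are the parameters;
  the formula \<open>\<phi>\<close> cannot mention the set whose existence is asserted.
\<close>

definition ax_extensionality :: "hc set \<Rightarrow> bool" where
  "ax_extensionality M \<longleftrightarrow>
     (\<forall>x\<in>M. \<forall>y\<in>M. (\<forall>z\<in>M. z \<in> elts x \<longleftrightarrow> z \<in> elts y) \<longrightarrow> x = y)"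

definition ax_foundation :: "hc set \<Rightarrow> bool" where
  "ax_foundation M \<longleftrightarrow>
     (\<forall>x\<in>M. (\<exists>y\<in>M. y \<in> elts x) \<longrightarrow>
        (\<exists>y\<in>M. y \<in> elts x \<and> \<not> (\<exists>z\<in>M. z \<in> elts x \<and> z \<in> elts y)))"

definition ax_pairing :: "hc set \<Rightarrow> bool" where
  "ax_pairing M \<longleftrightarrow>
     (\<forall>x\<in>M. \<forall>y\<in>M. \<exists>z\<in>M. \<forall>w\<in>M. w \<in> elts z \<longleftrightarrow> w = x \<or> w = y)"

definition ax_union :: "hc set \<Rightarrow> bool" where
  "ax_union M \<longleftrightarrow>
     (\<forall>x\<in>M. \<exists>u\<in>M. \<forall>w\<in>M. w \<in> elts u \<longleftrightarrow> (\<exists>y\<in>M. y \<in> elts x \<and> w \<in> elts y))"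

definition ax_power_set :: "hc set \<Rightarrow> bool" where
  "ax_power_set M \<longleftrightarrow>
     (\<forall>x\<in>M. \<exists>u\<in>M. \<forall>w\<in>M. w \<in> elts u \<longleftrightarrow> (\<forall>z\<in>M. z \<in> elts w \<longrightarrow> z \<in> elts x))"

definition ax_infinity :: "hc set \<Rightarrow> bool" where
  "ax_infinity M \<longleftrightarrow>
     (\<exists>u\<in>M. (\<exists>e\<in>M. e \<in> elts u \<and> (\<forall>z\<in>M. z \<notin> elts e)) \<and>
        (\<forall>x\<in>M. x \<in> elts u \<longrightarrow>
           (\<exists>s\<in>M. s \<in> elts u \<and> (\<forall>z\<in>M. z \<in> elts s \<longleftrightarrow> z \<in> elts x \<or> z = x))))"

definition ax_separation :: "hc set \<Rightarrow> bool" where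
  "ax_separation M \<longleftrightarrow>
     (\<forall>\<phi> k \<rho>. range \<rho> \<subseteq> M \<longrightarrow>
        (\<forall>x\<in>M. \<exists>u\<in>M. \<forall>w\<in>M. w \<in> elts u \<longleftrightarrow> w \<in> elts x \<and> sat M \<phi> (\<rho>(k := w))))"

definition ax_replacement :: "hc set \<Rightarrow> bool" where
  "ax_replacement M \<longleftrightarrow>
     (\<forall>\<phi> k l \<rho>. k \<noteq> l \<longrightarrow> range \<rho> \<subseteq> M \<longrightarrow>
        (\<forall>x\<in>M.
           (\<forall>w\<in>M. w \<in> elts x \<longrightarrow> (\<exists>!v. v \<in> M \<and> sat M \<phi> (\<rho>(k := w, l := v)))) \<longrightarrow>
           (\<exists>u\<in>M. \<forall>v\<in>M. v \<in> elts u \<longleftrightarrow>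
              (\<exists>w\<in>M. w \<in> elts x \<and> sat M \<phi> (\<rho>(k := w, l := v))))))"

definition ax_choice :: "hc set \<Rightarrow> bool" where
  "ax_choice M \<longleftrightarrow>
     (\<forall>x\<in>M.
        (\<forall>y\<in>M. y \<in> elts x \<longrightarrow> (\<exists>z\<in>M. z \<in> elts y)) \<and>
        (\<forall>y\<in>M. \<forall>y'\<in>M. y \<in> elts x \<and> y' \<in> elts x \<and> y \<noteq> y' \<longrightarrow>
           \<not> (\<exists>z\<in>M. z \<in> elts y \<and> z \<in> elts y')) \<longrightarrow>
        (\<exists>c\<in>M. \<forall>y\<in>M. y \<in> elts x \<longrightarrow> (\<exists>!z. z \<in> M \<and> z \<in> elts y \<and> z \<in> elts c)))"

definition models_ZFC :: "hc set \<Rightarrow> bool" where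
  "models_ZFC M \<longleftrightarrow>
     ax_extensionality M \<and> ax_foundation M \<and> ax_pairing M \<and> ax_union M \<and> ax_power_set M \<and>
     ax_infinity M \<and> ax_separation M \<and> ax_replacement M \<and> ax_choice M"

definition ctm_ZFC :: "hc set \<Rightarrow> bool" where
  "ctm_ZFC M \<longleftrightarrow> countable M \<and> (\<forall>x\<in>M. elts x \<subseteq> M) \<and> models_ZFC M"


section \<open>Forcing posets and regular open sets\<close>

definition lle :: "hc \<Rightarrow> hc \<Rightarrow> hc \<Rightarrow> bool" where
  "lle le q p \<longleftrightarrow> opair q p \<in> elts le"

definition forcing_poset :: "hc \<Rightarrow> hc \<Rightarrow> hc \<Rightarrow> bool" where
  "forcing_poset P le one \<longleftrightarrow>
     elts P \<noteq> {} \<and>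
     (\<forall>w\<in>elts le. \<exists>q\<in>elts P. \<exists>p\<in>elts P. w = opair q p) \<and>
     (\<forall>p\<in>elts P. lle le p p) \<and>
     (\<forall>p q r. lle le p q \<and> lle le q r \<longrightarrow> lle le p r) \<and>
     one \<in> elts P \<and> (\<forall>p\<in>elts P. lle le p one)"

definition down :: "hc \<Rightarrow> hc \<Rightarrow> hc \<Rightarrow> hc set" where
  "down P le p = {q \<in> elts P. lle le q p}"

definition ptop :: "hc \<Rightarrow> hc \<Rightarrow> hc topology" where
  "ptop P le = topology_generated_by (down P le ` elts P)"

text \<open>
  The operations of the complete Boolean algebra of regular open sets of a space; the order is
  inclusion and binary meet is intersection.  For the topology of a poset in \<open>M\<close> these formulas are
  absolute, so on sets and families belonging to \<open>M\<close> they give the operations as computed in \<open>M\<close>.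
\<close>

definition regular_open :: "'a topology \<Rightarrow> 'a set \<Rightarrow> bool" where
  "regular_open T U \<longleftrightarrow> T interior_of (T closure_of U) = U"

definition ro_Sup :: "'a topology \<Rightarrow> 'a set set \<Rightarrow> 'a set" where
  "ro_Sup T S = T interior_of (T closure_of (\<Union>S))"

definition ro_Inf :: "'a topology \<Rightarrow> 'a set set \<Rightarrow> 'a set" where
  "ro_Inf T S = T interior_of (topspace T \<inter> \<Inter>S)"

definition ro_compl :: "'a topology \<Rightarrow> 'a set \<Rightarrow> 'a set" where
  "ro_compl T U = T interior_of (topspace T - U)"

lemma regular_open_openin: "regular_open T U \<Longrightarrow> openin T U"
  unfolding regular_open_def by (metis openin_interior_of)

lemma openin_subset_int_cl: "openin T U \<Longrightarrow> U \<subseteq> T interior_of (T closure_of U)"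
  by (intro interior_of_maximal closure_of_subset openin_subset)

lemma regular_open_int_cl: "regular_open T (T interior_of (T closure_of U))"
proof -
  let ?V = "T interior_of (T closure_of U)"
  have "T closure_of ?V \<subseteq> T closure_of U"
    by (intro closure_of_minimal interior_of_subset closedin_closure_of)
  then have "T interior_of (T closure_of ?V) \<subseteq> ?V"
    by (rule interior_of_mono)
  moreover have "?V \<subseteq> T interior_of (T closure_of ?V)"
    by (intro openin_subset_int_cl openin_interior_of)
  ultimately show ?thesis
    unfolding regular_open_def by (rule subset_antisym)
qed

lemma regular_open_ro_Sup: "regular_open T (ro_Sup T S)"
  unfolding ro_Sup_def by (rule regular_open_int_cl)

lemma ro_Sup_upper:
  assumes "\<And>U. U \<in> S \<Longrightarrow> openin T U" "U \<in> S"
  shows "U \<subseteq> ro_Sup T S"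
proof -
  have "openin T (\<Union>S)" by (intro openin_Union assms(1))
  then have "\<Union>S \<subseteq> ro_Sup T S"
    unfolding ro_Sup_def by (rule openin_subset_int_cl)
  with assms(2) show ?thesis by blast
qed

lemma ro_Sup_least:
  assumes "regular_open T V" "\<And>U. U \<in> S \<Longrightarrow> U \<subseteq> V"
  shows "ro_Sup T S \<subseteq> V"
proof -
  have "\<Union>S \<subseteq> V" using assms(2) by blast
  then have "ro_Sup T S \<subseteq> T interior_of (T closure_of V)"
    unfolding ro_Sup_def by (intro interior_of_mono closure_of_mono)
  with assms(1) show ?thesis by (simp add: regular_open_def)
qed

lemma regular_open_ro_Inf:
  assumes "\<And>U. U \<in> S \<Longrightarrow> regular_open T U"
  shows "regular_open T (ro_Inf T S)"
proof -
  let ?I = "ro_Inf T S"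
  have "T interior_of (T closure_of ?I) \<subseteq> U" if "U \<in> S" for U
  proof -
    have "?I \<subseteq> topspace T \<inter> \<Inter>S" unfolding ro_Inf_def by (rule interior_of_subset)
    with that have "?I \<subseteq> U" by blast
    then have "T interior_of (T closure_of ?I) \<subseteq> T interior_of (T closure_of U)"
      by (intro interior_of_mono closure_of_mono)
    with assms[OF that] show ?thesis by (simp add: regular_open_def)
  qed
  then have "T interior_of (T closure_of ?I) \<subseteq> topspace T \<inter> \<Inter>S"
    by (intro Int_greatest Inter_greatest interior_of_subset_topspace)
  then have "T interior_of (T closure_of ?I) \<subseteq> ?I"
    unfolding ro_Inf_def by (intro interior_of_maximal openin_interior_of)
  moreover have "?I \<subseteq> T interior_of (T closure_of ?I)"
    unfolding ro_Inf_def by (intro openin_subset_int_cl openin_interior_of)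
  ultimately show ?thesis
    unfolding regular_open_def by (rule subset_antisym)
qed

lemma ro_Inf_lower:
  assumes "U \<in> S"
  shows "ro_Inf T S \<subseteq> U"
proof -
  have "ro_Inf T S \<subseteq> topspace T \<inter> \<Inter>S" unfolding ro_Inf_def by (rule interior_of_subset)
  with assms show ?thesis by blast
qed

lemma ro_Inf_greatest:
  assumes "openin T V" "\<And>U. U \<in> S \<Longrightarrow> V \<subseteq> U"
  shows "V \<subseteq> ro_Inf T S"
  unfolding ro_Inf_def
  by (intro interior_of_maximal Int_greatest Inter_greatest openin_subset assms)

lemma ro_compl_Int: "U \<inter> ro_compl T U = {}"
proof -
  have "ro_compl T U \<subseteq> topspace T - U" unfolding ro_compl_def by (rule interior_of_subset)
  then show ?thesis by blast
qed

lemma ro_compl_Sup: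
  shows "ro_Sup T {U, ro_compl T U} = topspace T"
proof -
  have eq: "ro_compl T U = topspace T - T closure_of U"
    unfolding ro_compl_def by (rule interior_of_complement)
  have "ro_compl T U \<subseteq> T closure_of (ro_compl T U)"
    unfolding ro_compl_def by (intro closure_of_subset interior_of_subset_topspace)
  then have "topspace T \<subseteq> T closure_of U \<union> T closure_of (ro_compl T U)"
    unfolding eq by blast
  then have "topspace T \<subseteq> T closure_of (\<Union>{U, ro_compl T U})"
    by (simp add: closure_of_Un)
  then have "T closure_of (\<Union>{U, ro_compl T U}) = topspace T"
    by (intro subset_antisym closure_of_subset_topspace)
  then show ?thesis
    unfolding ro_Sup_def by simp
qed

definition canon :: "hc \<Rightarrow> hc \<Rightarrow> hc \<Rightarrow> hc set" where
  "canon P le p = ptop P le interior_of (ptop P le closure_of down P le p)"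

text \<open>
  The underlying set of \<open>\<bool>\<close> as computed in \<open>M\<close>.  Elements of \<open>\<bool>\<close> are objects of type \<open>hc\<close> when
  they occur inside names, and plain sets of conditions when they occur as Boolean values;
  \<open>elts\<close> and \<open>mk\<close> translate between the two.
\<close>

definition RO :: "hc set \<Rightarrow> hc topology \<Rightarrow> hc set" where
  "RO M T = {b \<in> M. regular_open T (elts b)}"


section \<open>Names\<close>

inductive name :: "hc set \<Rightarrow> hc \<Rightarrow> bool" for Q where
  "(\<forall>w\<in>elts x. \<exists>y q. w = opair y q \<and> name Q y \<and> q \<in> Q) \<Longrightarrow> name Q x"

definition names :: "hc set \<Rightarrow> hc set \<Rightarrow> hc set" where
  "names M Q = {x \<in> M. name Q x}"

function i_star :: "hc \<Rightarrow> hc \<Rightarrow> hc \<Rightarrow> hc" where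
  "i_star P le x =
     mk {w. \<exists>y\<in>vdom x. \<exists>q. opair y q \<in> elts x \<and> w = opair (i_star P le y) (mk (canon P le q))}"
  by auto
termination
  by (relation "inv_image (mem_rel\<^sup>+) (\<lambda>(P, le, x). x)") (auto simp: wf_mem_trancl vdom_mem)

function retr :: "hc topology \<Rightarrow> hc \<Rightarrow> hc" where
  "retr T x =
     mk ((\<lambda>y. opair (retr T y)
               (mk (ro_Sup T {elts p |p. \<exists>z\<in>vdom x. opair z p \<in> elts x \<and> retr T z = retr T y})))
         ` vdom x)"
  by auto
termination
  by (relation "inv_image (mem_rel\<^sup>+) (\<lambda>(T, x). x)") (auto simp: wf_mem_trancl vdom_mem)


section \<open>The Boolean-valued universe\<close>

function VB_level :: "hc set \<Rightarrow> hc topology \<Rightarrow> hc \<Rightarrow> hc set" where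
  "VB_level M T \<alpha> =
     (if \<exists>\<beta>. \<alpha> = vsucc \<beta>
      then {x \<in> M. is_fun x \<and> vran x \<subseteq> RO M T \<and> (\<exists>\<beta>\<in>elts \<alpha>. \<alpha> = vsucc \<beta> \<and> vdom x \<subseteq> VB_level M T \<beta>)}
      else (\<Union>\<beta>\<in>elts \<alpha>. VB_level M T \<beta>))"
  by auto
termination
  by (relation "inv_image mem_rel (\<lambda>(M, T, \<alpha>). \<alpha>)")
    (auto simp: wf_mem_rel mem_rel_iff)

declare i_star.simps [simp del] retr.simps [simp del] VB_level.simps [simp del]

lemma VB_level_0: "VB_level M T (mk {}) = {}"
proof -
  have "mk {} \<noteq> vsucc \<beta>" for \<beta>
    using mem_vsucc[of \<beta>] by (metis countable_empty elts_mk empty_iff)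
  then show ?thesis by (subst VB_level.simps) auto
qed

lemma VB_level_succ:
  "VB_level M T (vsucc \<beta>) = {x \<in> M. is_fun x \<and> vdom x \<subseteq> VB_level M T \<beta> \<and> vran x \<subseteq> RO M T}"
  by (subst VB_level.simps) (auto simp: mem_vsucc)

lemma VB_level_limit:
  "(\<And>\<beta>. \<alpha> \<noteq> vsucc \<beta>) \<Longrightarrow> VB_level M T \<alpha> = (\<Union>\<beta>\<in>elts \<alpha>. VB_level M T \<beta>)"
  by (subst VB_level.simps) auto

definition VB :: "hc set \<Rightarrow> hc topology \<Rightarrow> hc set" where
  "VB M T = (\<Union>\<alpha>\<in>{\<alpha> \<in> M. is_ord \<alpha>}. VB_level M T \<alpha>)"


section \<open>Boolean values\<close>

lemma mult_mem_rel_pair: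
  assumes "t \<in> vdom y"
  shows "({#x, t#}, {#x, y#}) \<in> mult (mem_rel\<^sup>+)" "({#t, x#}, {#y, x#}) \<in> mult (mem_rel\<^sup>+)"
    "({#t, x#}, {#x, y#}) \<in> mult (mem_rel\<^sup>+)" "({#x, t#}, {#y, x#}) \<in> mult (mem_rel\<^sup>+)"
proof -
  have "({#x#} + {#t#}, {#x#} + {#y#}) \<in> mult (mem_rel\<^sup>+)"
    by (rule one_step_implies_mult) (simp_all add: vdom_mem[OF assms])
  moreover have "{#x#} + {#t#} = {#x, t#}" "{#x#} + {#y#} = {#x, y#}" by simp_all
  ultimately show "({#x, t#}, {#x, y#}) \<in> mult (mem_rel\<^sup>+)" by metis
  then show "({#t, x#}, {#y, x#}) \<in> mult (mem_rel\<^sup>+)"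
    "({#t, x#}, {#x, y#}) \<in> mult (mem_rel\<^sup>+)" "({#x, t#}, {#y, x#}) \<in> mult (mem_rel\<^sup>+)"
    by (simp_all add: add_mset_commute)
qed

function
  bmem :: "hc topology \<Rightarrow> hc \<Rightarrow> hc \<Rightarrow> hc set" and
  bsub :: "hc topology \<Rightarrow> hc \<Rightarrow> hc \<Rightarrow> hc set" and
  beq :: "hc topology \<Rightarrow> hc \<Rightarrow> hc \<Rightarrow> hc set" where
  "bmem T x y = ro_Sup T ((\<lambda>t. beq T x t \<inter> elts (app y t)) ` vdom y)"
| "bsub T x y = ro_Inf T ((\<lambda>t. ro_Sup T {ro_compl T (elts (app x t)), bmem T t y}) ` vdom x)"
| "beq T x y = bsub T x y \<inter> bsub T y x"
  by pat_completeness auto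
termination
  by (relation "inv_image (mult (mem_rel\<^sup>+) <*lex*> less_than)
      (\<lambda>a. case a of
         Inl (T, x, y) \<Rightarrow> ({#x, y#}, 0)
       | Inr (Inl (T, x, y)) \<Rightarrow> ({#x, y#}, 0)
       | Inr (Inr (T, x, y)) \<Rightarrow> ({#x, y#}, 1 :: nat))")
    (simp_all add: wf_mult wf_mem_trancl wf_lex_prod mult_mem_rel_pair add_mset_commute)

declare bmem.simps [simp del] bsub.simps [simp del] beq.simps [simp del]

primrec bval :: "hc set \<Rightarrow> hc topology \<Rightarrow> fm \<Rightarrow> (nat \<Rightarrow> hc) \<Rightarrow> hc set" where
  "bval M T (Mem k l) \<rho> = bmem T (\<rho> k) (\<rho> l)"
| "bval M T (Eq k l) \<rho> = beq T (\<rho> k) (\<rho> l)"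
| "bval M T (Neg \<phi>) \<rho> = ro_compl T (bval M T \<phi> \<rho>)"
| "bval M T (And \<phi> \<psi>) \<rho> = bval M T \<phi> \<rho> \<inter> bval M T \<psi> \<rho>"
| "bval M T (Or \<phi> \<psi>) \<rho> = ro_Sup T {bval M T \<phi> \<rho>, bval M T \<psi> \<rho>}"
| "bval M T (Imp \<phi> \<psi>) \<rho> = ro_Sup T {ro_compl T (bval M T \<phi> \<rho>), bval M T \<psi> \<rho>}"
| "bval M T (Iff \<phi> \<psi>) \<rho> =
     ro_Sup T {ro_compl T (bval M T \<phi> \<rho>), bval M T \<psi> \<rho>} \<inter>
     ro_Sup T {ro_compl T (bval M T \<psi> \<rho>), bval M T \<phi> \<rho>}"
| "bval M T (All k \<phi>) \<rho> = ro_Inf T ((\<lambda>x. bval M T \<phi> (\<rho>(k := x))) ` VB M T)"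
| "bval M T (Ex k \<phi>) \<rho> = ro_Sup T ((\<lambda>x. bval M T \<phi> (\<rho>(k := x))) ` VB M T)"


section \<open>The forcing relation of the poset\<close>

definition dense_below :: "hc \<Rightarrow> hc \<Rightarrow> hc \<Rightarrow> hc set \<Rightarrow> bool" where
  "dense_below P le p D \<longleftrightarrow> (\<forall>q\<in>down P le p. \<exists>s\<in>down P le q. s \<in> D)"

text \<open>
  The weights used for termination: \<open>feq x y\<close> calls \<open>fmem z x\<close> also for \<open>z\<close> in the domain of \<open>y\<close>.
\<close>

lemma mult_mem_rel_forcing:
  "z \<in> vdom y \<Longrightarrow> ({#x, x, x, z, z, z#}, {#x, x, x, y, y#}) \<in> mult (mem_rel\<^sup>+)"
  "z \<in> vdom x \<or> z \<in> vdom y \<Longrightarrow> ({#z, z, z, x, x#}, {#x, x, x, y, y, y#}) \<in> mult (mem_rel\<^sup>+)"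
  "z \<in> vdom x \<or> z \<in> vdom y \<Longrightarrow> ({#z, z, z, y, y#}, {#x, x, x, y, y, y#}) \<in> mult (mem_rel\<^sup>+)"
proof -
  assume "z \<in> vdom y"
  then have "({#x, x, x#} + {#z, z, z#}, {#x, x, x#} + {#y, y#}) \<in> mult (mem_rel\<^sup>+)"
    by (intro one_step_implies_mult) (simp_all add: vdom_mem)
  moreover have "{#x, x, x#} + {#z, z, z#} = {#x, x, x, z, z, z#}" by simp
  moreover have "{#x, x, x#} + {#y, y#} = {#x, x, x, y, y#}" by simp
  ultimately show "({#x, x, x, z, z, z#}, {#x, x, x, y, y#}) \<in> mult (mem_rel\<^sup>+)" by metis
next
  assume *: "z \<in> vdom x \<or> z \<in> vdom y"
  then have "({#x, x#} + {#z, z, z#}, {#x, x#} + {#x, y, y, y#}) \<in> mult (mem_rel\<^sup>+)"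
    by (intro one_step_implies_mult) (auto simp: vdom_mem)
  moreover have "{#x, x#} + {#z, z, z#} = {#z, z, z, x, x#}" by simp
  moreover have "{#x, x#} + {#x, y, y, y#} = {#x, x, x, y, y, y#}" by simp
  ultimately show "({#z, z, z, x, x#}, {#x, x, x, y, y, y#}) \<in> mult (mem_rel\<^sup>+)" by metis
  from * have "({#y, y#} + {#z, z, z#}, {#y, y#} + {#x, x, x, y#}) \<in> mult (mem_rel\<^sup>+)"
    by (intro one_step_implies_mult) (auto simp: vdom_mem)
  moreover have "{#y, y#} + {#z, z, z#} = {#z, z, z, y, y#}" by simp
  moreover have "{#y, y#} + {#x, x, x, y#} = {#x, x, x, y, y, y#}" by simp
  ultimately show "({#z, z, z, y, y#}, {#x, x, x, y, y, y#}) \<in> mult (mem_rel\<^sup>+)" by metis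
qed

function
  fmem :: "hc \<Rightarrow> hc \<Rightarrow> hc \<Rightarrow> hc \<Rightarrow> hc \<Rightarrow> bool" and
  feq :: "hc \<Rightarrow> hc \<Rightarrow> hc \<Rightarrow> hc \<Rightarrow> hc \<Rightarrow> bool" where
  "fmem P le p x y \<longleftrightarrow>
     dense_below P le p
       {q \<in> down P le p. \<exists>z\<in>vdom y. \<exists>r. opair z r \<in> elts y \<and> lle le q r \<and> feq P le q x z}"
| "feq P le p x y \<longleftrightarrow>
     (\<forall>z\<in>vdom x \<union> vdom y. \<forall>q\<in>down P le p. fmem P le q z x \<longleftrightarrow> fmem P le q z y)"
  by pat_completeness auto
termination
  by (relation "inv_image (mult (mem_rel\<^sup>+))
      (\<lambda>a. case a of
         Inl (P, le, p, x, y) \<Rightarrow> {#x, x, x, y, y#}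
       | Inr (P, le, p, x, y) \<Rightarrow> {#x, x, x, y, y, y#})")
    (simp_all add: wf_mult wf_mem_trancl mult_mem_rel_forcing)

declare fmem.simps [simp del] feq.simps [simp del]

primrec forces :: "hc set \<Rightarrow> hc \<Rightarrow> hc \<Rightarrow> fm \<Rightarrow> (nat \<Rightarrow> hc) \<Rightarrow> hc \<Rightarrow> bool" where
  "forces M P le (Mem k l) \<rho> p \<longleftrightarrow> fmem P le p (\<rho> k) (\<rho> l)"
| "forces M P le (Eq k l) \<rho> p \<longleftrightarrow> feq P le p (\<rho> k) (\<rho> l)"
| "forces M P le (Neg \<phi>) \<rho> p \<longleftrightarrow> \<not> (\<exists>q\<in>down P le p. forces M P le \<phi> \<rho> q)"
| "forces M P le (And \<phi> \<psi>) \<rho> p \<longleftrightarrow> forces M P le \<phi> \<rho> p \<and> forces M P le \<psi> \<rho> p"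
| "forces M P le (Or \<phi> \<psi>) \<rho> p \<longleftrightarrow>
     dense_below P le p {q \<in> elts P. forces M P le \<phi> \<rho> q \<or> forces M P le \<psi> \<rho> q}"
| "forces M P le (Imp \<phi> \<psi>) \<rho> p \<longleftrightarrow>
     \<not> (\<exists>q\<in>down P le p. forces M P le \<phi> \<rho> q \<and> \<not> (\<exists>s\<in>down P le q. forces M P le \<psi> \<rho> s))"
| "forces M P le (Iff \<phi> \<psi>) \<rho> p \<longleftrightarrow>
     \<not> (\<exists>q\<in>down P le p. forces M P le \<phi> \<rho> q \<and> \<not> (\<exists>s\<in>down P le q. forces M P le \<psi> \<rho> s)) \<and>
     \<not> (\<exists>q\<in>down P le p. \<not> (\<exists>s\<in>down P le q. forces M P le \<phi> \<rho> s) \<and> forces M P le \<psi> \<rho> q)"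
| "forces M P le (All k \<phi>) \<rho> p \<longleftrightarrow> (\<forall>x\<in>names M (elts P). forces M P le \<phi> (\<rho>(k := x)) p)"
| "forces M P le (Ex k \<phi>) \<rho> p \<longleftrightarrow>
     dense_below P le p {q \<in> elts P. \<exists>x\<in>names M (elts P). forces M P le \<phi> (\<rho>(k := x)) q}"

end

theory Submission
  imports Defs "HOL-Library.Nat_Bijection"
begin

text \<open>
  Everything is reduced to \<open>p \<tturnstile>* \<phi> \<longleftrightarrow> p \<in> \<parallel>\<phi>\<parallel>\<close>, where Boolean values are regular open sets and hence
  contain \<open>i(p)\<close> iff they contain \<open>p\<close>.  Put \<open>e = r \<circ> i\<^sub>*\<close>.  The value of \<open>e(y)\<close> at \<open>e(z)\<close> is the join of
  all \<open>i(q)\<close> with \<open>(z', q) \<in> y\<close> and \<open>e(z') = e(z)\<close>, so \<open>p \<in> \<parallel>u \<in> e(y)\<parallel>\<close> says that below \<open>p\<close> there are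
  densely many \<open>r\<close> with \<open>r \<le> q\<close> and \<open>r \<in> \<parallel>u = e(z)\<parallel>\<close> for some \<open>(z, q) \<in> y\<close>: this is the clause that
  defines the forcing relation on \<open>\<in>\<close>, and the atomic case follows by well-founded recursion on pairs of
  names.  For quantifiers one needs that \<open>e\<close> maps the names of \<open>M\<close> into \<open>V\<^sup>B\<close> and that it is onto up to
  Boolean equality; a right inverse is \<open>u \<mapsto> {(j(t), p) : t \<in> dom u, p \<in> u(t)}\<close>.  Both maps, and a
  rank that locates a given element in the hierarchy, are defined by recursion on the domain of a name,
  and \<open>M\<close> is closed under such recursions by Replacement.
\<close>

section \<open>Definability over a model\<close>

text \<open>The quantifiers run over different classes: names in M for forcing,
  \<open>VB M T\<close> for Boolean values. Only the sets of values taken have to be matched, and a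
  value does not change when an argument is replaced by a Boolean-equal one; hence a right inverse
  up to Boolean equality suffices. The one used is no exact inverse: an entry of u with value 0
  leaves no pair in the translated name.

  The main obstacle is to keep both maps inside M. They are recursive functions on the ambient type,
  whereas Replacement speaks of formulas evaluated in M. These formulas are never written out:
  \<open>definable\<close> is a property of predicates on assignments, closed under connectives,
  quantifiers over M and substitution, and \<open>definable_term\<close> is the matching property of
  set-valued operations. Once a recursion step is written as such an operation, closure rules that
  follow its shape do the rest. The topology is not treated in this way: the joins in e are
  rewritten as conditions on the order, with all quantifiers bounded by sets in M.\<close>

lemma finite_fv: "finite (fv \<phi>)"
  by (induction \<phi>) auto

lemma sat_cong: "(\<And>n. n \<in> fv \<phi> \<Longrightarrow> \<rho> n = \<sigma> n) \<Longrightarrow> sat M \<phi> \<rho> \<longleftrightarrow> sat M \<phi> \<sigma>"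
proof (induction \<phi> arbitrary: \<rho> \<sigma>)
  case (All k \<phi>)
  have "sat M \<phi> (\<rho>(k := x)) \<longleftrightarrow> sat M \<phi> (\<sigma>(k := x))" for x
    by (rule All.IH) (use All.prems in auto)
  then show ?case by simp
next
  case (Ex k \<phi>)
  have "sat M \<phi> (\<rho>(k := x)) \<longleftrightarrow> sat M \<phi> (\<sigma>(k := x))" for x
    by (rule Ex.IH) (use Ex.prems in auto)
  then show ?case by simp
next
  case (And \<phi> \<psi>)
  then show ?case by (metis Un_iff fv.simps(4) sat.simps(4))
next
  case (Or \<phi> \<psi>)
  then show ?case by (metis Un_iff fv.simps(5) sat.simps(5))
next
  case (Imp \<phi> \<psi>)
  then show ?case by (metis Un_iff fv.simps(6) sat.simps(6))
next
  case (Iff \<phi> \<psi>)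
  then show ?case by (metis Un_iff fv.simps(7) sat.simps(7))
next
  case (Neg \<phi>)
  then show ?case by (metis fv.simps(3) sat.simps(3))
qed auto

lemma ex_fresh: "finite A \<Longrightarrow> \<exists>k::nat. k \<notin> A"
  using ex_new_if_finite infinite_UNIV_nat by blast

text \<open>The renaming \<open>f\<close> may identify variables. A bound variable is moved to some
  \<open>k'\<close> outside the image under \<open>f\<close> of the free variables of the body, so
  nothing is captured. Later uses need only the existence of the renamed formula.\<close>

lemma sat_rename: "\<exists>\<psi>. \<forall>\<rho>. sat M \<psi> \<rho> \<longleftrightarrow> sat M \<phi> (\<lambda>n. \<rho> (f n))"
proof (induction \<phi> arbitrary: f)
  case (Mem k l)
  show ?case by (rule exI[of _ "Mem (f k) (f l)"]) simp
next
  case (Eq k l)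
  show ?case by (rule exI[of _ "Eq (f k) (f l)"]) simp
next
  case (Neg \<phi>)
  then show ?case by (metis sat.simps(3))
next
  case (And \<phi> \<psi>)
  then show ?case by (metis sat.simps(4))
next
  case (Or \<phi> \<psi>)
  then show ?case by (metis sat.simps(5))
next
  case (Imp \<phi> \<psi>)
  then show ?case by (metis sat.simps(6))
next
  case (Iff \<phi> \<psi>)
  then show ?case by (metis sat.simps(7))
next
  case (All k \<phi>)
  obtain k' where k': "k' \<notin> f ` fv \<phi>"
    using ex_fresh[OF finite_imageI[OF finite_fv]] by blast
  obtain \<psi> where \<psi>: "\<And>\<rho>. sat M \<psi> \<rho> \<longleftrightarrow> sat M \<phi> (\<lambda>n. \<rho> ((f(k := k')) n))"
    using All.IH by blast
  have "sat M \<psi> (\<rho>(k' := x)) \<longleftrightarrow> sat M \<phi> ((\<lambda>n. \<rho> (f n))(k := x))" for \<rho> x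
    unfolding \<psi> by (rule sat_cong) (use k' in auto)
  then show ?case by (intro exI[of _ "All k' \<psi>"]) simp
next
  case (Ex k \<phi>)
  obtain k' where k': "k' \<notin> f ` fv \<phi>"
    using ex_fresh[OF finite_imageI[OF finite_fv]] by blast
  obtain \<psi> where \<psi>: "\<And>\<rho>. sat M \<psi> \<rho> \<longleftrightarrow> sat M \<phi> (\<lambda>n. \<rho> ((f(k := k')) n))"
    using Ex.IH by blast
  have "sat M \<psi> (\<rho>(k' := x)) \<longleftrightarrow> sat M \<phi> ((\<lambda>n. \<rho> (f n))(k := x))" for \<rho> x
    unfolding \<psi> by (rule sat_cong) (use k' in auto)
  then show ?case by (intro exI[of _ "Ex k' \<psi>"]) simp
qed

text \<open>Even variables hold the arguments, odd variables the parameters.\<close>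

definition env :: "(nat \<Rightarrow> hc) \<Rightarrow> (nat \<Rightarrow> hc) \<Rightarrow> nat \<Rightarrow> hc" where
  "env \<rho> \<sigma> n = case_sum \<rho> \<sigma> (sum_decode n)"

lemma env_encode [simp]: "env \<rho> \<sigma> (sum_encode (Inl n)) = \<rho> n" "env \<rho> \<sigma> (sum_encode (Inr n)) = \<sigma> n"
  by (simp_all add: env_def)

text \<open>The predicate lives in the metalogic, the formula is hidden by a quantifier, and the two
  have to agree only on assignments into M. Definability of a composite condition thus follows by
  introduction rules from its shape. The sequence \<open>\<sigma>\<close> supplies parameters from
  M.\<close>

definition definable :: "hc set \<Rightarrow> ((nat \<Rightarrow> hc) \<Rightarrow> bool) \<Rightarrow> bool" where
  "definable M A \<longleftrightarrow> (\<exists>\<phi> \<sigma>. (\<forall>i. \<sigma> i \<in> M) \<and> (\<forall>\<rho>. (\<forall>i. \<rho> i \<in> M) \<longrightarrow> (A \<rho> \<longleftrightarrow> sat M \<phi> (env \<rho> \<sigma>))))"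

text \<open>De Bruijn indices: variable \<open>0\<close> is the value of the term, and the arguments are shifted by one.  The
  rules for binders below have premises of the same shape.\<close>

definition definable_term :: "hc set \<Rightarrow> ((nat \<Rightarrow> hc) \<Rightarrow> hc) \<Rightarrow> bool" where
  "definable_term M t \<longleftrightarrow> (\<forall>\<rho>. (\<forall>i. \<rho> i \<in> M) \<longrightarrow> t \<rho> \<in> M) \<and> definable M (\<lambda>\<rho>. \<rho> 0 = t (\<lambda>n. \<rho> (Suc n)))"

lemma definable_cong: "definable M A \<Longrightarrow> (\<And>\<rho>. \<forall>i. \<rho> i \<in> M \<Longrightarrow> A \<rho> \<longleftrightarrow> B \<rho>) \<Longrightarrow> definable M B"
  unfolding definable_def by auto

text \<open>The map \<open>g\<close> tells for each variable of \<open>\<phi>\<close> whether it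
  reads an argument or a parameter; \<open>sat_rename\<close> then translates this into the coding
  by \<open>env\<close>.\<close>

lemma definableI:
  fixes g :: "nat \<Rightarrow> nat + nat"
  assumes "\<forall>i. \<sigma> i \<in> M" "\<And>\<rho>. \<forall>i. \<rho> i \<in> M \<Longrightarrow> A \<rho> \<longleftrightarrow> sat M \<phi> (\<lambda>n. case_sum \<rho> \<sigma> (g n))"
  shows "definable M A"
proof -
  obtain \<psi> where "\<And>\<rho>. sat M \<psi> \<rho> \<longleftrightarrow> sat M \<phi> (\<lambda>n. \<rho> (sum_encode (g n)))"
    using sat_rename[where M = M and \<phi> = \<phi> and f = "\<lambda>n. sum_encode (g n)"] by auto
  then have "sat M \<psi> (env \<rho> \<sigma>) \<longleftrightarrow> sat M \<phi> (\<lambda>n. case_sum \<rho> \<sigma> (g n))" for \<rho>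
    by (simp add: env_def)
  with assms show ?thesis unfolding definable_def by blast
qed

lemma definable_rename: "definable M A \<Longrightarrow> definable M (\<lambda>\<rho>. A (\<lambda>n. \<rho> (f n)))"
proof -
  assume "definable M A"
  then obtain \<phi> \<sigma> where \<sigma>: "\<forall>i. \<sigma> i \<in> M"
    and \<phi>: "\<And>\<rho>. \<forall>i. \<rho> i \<in> M \<Longrightarrow> A \<rho> \<longleftrightarrow> sat M \<phi> (env \<rho> \<sigma>)"
    unfolding definable_def by blast
  have "env (\<lambda>n. \<rho> (f n)) \<sigma> = (\<lambda>n. case_sum \<rho> \<sigma> (map_sum f id (sum_decode n)))" for \<rho>
    by (auto simp: env_def fun_eq_iff split: sum.split)
  moreover have "\<forall>i. \<rho> (f i) \<in> M" if "\<forall>i. \<rho> i \<in> M" for \<rho> :: "nat \<Rightarrow> hc"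
    using that by auto
  ultimately show ?thesis
    by (intro definableI[OF \<sigma>, where \<phi> = \<phi> and g = "\<lambda>n. map_sum f id (sum_decode n)"]) (simp add: \<phi>)
qed

section \<open>Closure of definable predicates under logical operations\<close>

lemma definable_neg: "definable M A \<Longrightarrow> definable M (\<lambda>\<rho>. \<not> A \<rho>)"
proof -
  assume "definable M A"
  then obtain \<phi> \<sigma> where "\<forall>i. \<sigma> i \<in> M" "\<And>\<rho>. \<forall>i. \<rho> i \<in> M \<Longrightarrow> A \<rho> \<longleftrightarrow> sat M \<phi> (env \<rho> \<sigma>)"
    unfolding definable_def by blast
  then show ?thesis
    unfolding definable_def by (intro exI[of _ "Neg \<phi>"] exI[of _ \<sigma>]) simp
qed

text \<open>Each formula brings its own parameter sequence. The two are interleaved by a second use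
  of \<open>env\<close>, and in each formula parameter \<open>m\<close> is redirected to its new
  place, while the arguments are shared.\<close>

lemma definable_and:
  assumes "definable M A" "definable M B"
  shows "definable M (\<lambda>\<rho>. A \<rho> \<and> B \<rho>)"
proof -
  obtain \<phi>1 \<sigma>1 where 1: "\<forall>i. \<sigma>1 i \<in> M" "\<And>\<rho>. \<forall>i. \<rho> i \<in> M \<Longrightarrow> A \<rho> \<longleftrightarrow> sat M \<phi>1 (env \<rho> \<sigma>1)"
    using assms(1) unfolding definable_def by blast
  obtain \<phi>2 \<sigma>2 where 2: "\<forall>i. \<sigma>2 i \<in> M" "\<And>\<rho>. \<forall>i. \<rho> i \<in> M \<Longrightarrow> B \<rho> \<longleftrightarrow> sat M \<phi>2 (env \<rho> \<sigma>2)"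
    using assms(2) unfolding definable_def by blast
  obtain \<psi>1 where \<psi>1: "\<And>\<rho>. sat M \<psi>1 \<rho> \<longleftrightarrow> sat M \<phi>1 (\<lambda>n. \<rho> (case sum_decode n of
      Inl m \<Rightarrow> sum_encode (Inl m) | Inr m \<Rightarrow> sum_encode (Inr (sum_encode (Inl m)))))"
    using sat_rename[where M = M and \<phi> = \<phi>1 and f = "\<lambda>n. case sum_decode n of
      Inl m \<Rightarrow> sum_encode (Inl m) | Inr m \<Rightarrow> sum_encode (Inr (sum_encode (Inl m)))"] by auto
  obtain \<psi>2 where \<psi>2: "\<And>\<rho>. sat M \<psi>2 \<rho> \<longleftrightarrow> sat M \<phi>2 (\<lambda>n. \<rho> (case sum_decode n of
      Inl m \<Rightarrow> sum_encode (Inl m) | Inr m \<Rightarrow> sum_encode (Inr (sum_encode (Inr m)))))"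
    using sat_rename[where M = M and \<phi> = \<phi>2 and f = "\<lambda>n. case sum_decode n of
      Inl m \<Rightarrow> sum_encode (Inl m) | Inr m \<Rightarrow> sum_encode (Inr (sum_encode (Inr m)))"] by auto
  let ?\<sigma> = "env \<sigma>1 \<sigma>2"
  have "\<forall>i. ?\<sigma> i \<in> M"
    using 1(1) 2(1) by (auto simp: env_def split: sum.split)
  moreover have "sat M \<psi>1 (env \<rho> ?\<sigma>) \<longleftrightarrow> sat M \<phi>1 (env \<rho> \<sigma>1)" for \<rho>
    unfolding \<psi>1 by (rule sat_cong) (auto simp: env_def[of \<rho> \<sigma>1] split: sum.split)
  moreover have "sat M \<psi>2 (env \<rho> ?\<sigma>) \<longleftrightarrow> sat M \<phi>2 (env \<rho> \<sigma>2)" for \<rho>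
    unfolding \<psi>2 by (rule sat_cong) (auto simp: env_def[of \<rho> \<sigma>2] split: sum.split)
  ultimately show ?thesis
    unfolding definable_def using 1(2) 2(2)
    by (intro exI[of _ "And \<psi>1 \<psi>2"] exI[of _ ?\<sigma>]) simp
qed

text \<open>The binder takes argument 0, but formulas have named variables. Some \<open>k\<close> is
  bound instead: the renaming \<open>?f\<close> sends argument 0 to \<open>k\<close>, shifts the
  other arguments down by one and keeps the parameters.\<close>

lemma definable_ex:
  assumes "definable M (\<lambda>\<rho>. Q (\<lambda>n. \<rho> (Suc n)) (\<rho> 0))"
  shows "definable M (\<lambda>\<rho>. \<exists>x\<in>M. Q \<rho> x)"
proof -
  obtain \<phi> \<sigma> where \<sigma>: "\<forall>i. \<sigma> i \<in> M"
    and \<phi>: "\<And>\<rho>. \<forall>i. \<rho> i \<in> M \<Longrightarrow> Q (\<lambda>n. \<rho> (Suc n)) (\<rho> 0) \<longleftrightarrow> sat M \<phi> (env \<rho> \<sigma>)"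
    using assms unfolding definable_def by blast
  \<comment> \<open>The positions that \<open>k\<close> has to avoid: those where the renaming puts
    the variables other than argument 0. The truncated subtraction also sends argument 0 to itself,
    which can only exclude one more position.\<close>
  let ?h = "\<lambda>n. case sum_decode n of Inl m \<Rightarrow> sum_encode (Inl (m - 1)) | Inr m \<Rightarrow> n"
  obtain k where k: "k \<notin> ?h ` fv \<phi>"
    using ex_fresh[OF finite_imageI[OF finite_fv]] by blast
  let ?f = "\<lambda>n. case sum_decode n of Inl m \<Rightarrow> (case m of 0 \<Rightarrow> k | Suc i \<Rightarrow> sum_encode (Inl i)) | Inr m \<Rightarrow> n"
  have kh: "k \<noteq> ?h n" if "n \<in> fv \<phi>" for n
    using k that by blast
  have k': "k \<noteq> sum_encode (Inl m)" if "n \<in> fv \<phi>" "sum_decode n = Inl (Suc m)" for n m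
    using kh[OF that(1)] that(2) by simp
  have k'': "k \<noteq> n" if "n \<in> fv \<phi>" "sum_decode n = Inr m" for n m
    using kh[OF that(1)] that(2) by simp
  obtain \<psi> where \<psi>: "\<And>\<rho>. sat M \<psi> \<rho> \<longleftrightarrow> sat M \<phi> (\<lambda>n. \<rho> (?f n))"
    using sat_rename[where M = M and \<phi> = \<phi> and f = ?f] by auto
  have eq: "sat M \<psi> ((env \<rho> \<sigma>)(k := x)) \<longleftrightarrow> sat M \<phi> (env (case_nat x \<rho>) \<sigma>)" for \<rho> x
    unfolding \<psi>
  proof (rule sat_cong)
    fix n assume n: "n \<in> fv \<phi>"
    show "((env \<rho> \<sigma>)(k := x)) (?f n) = env (case_nat x \<rho>) \<sigma> n"
    proof (cases "sum_decode n")
      case (Inl m)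
      then show ?thesis
        using k'[OF n] by (cases m) (auto simp: env_def[of "case_nat x \<rho>"])
    next
      case (Inr m)
      then have "n = sum_encode (Inr m)" by (metis sum_decode_inverse)
      with Inr show ?thesis
        using k''[OF n] by (auto simp: env_def)
    qed
  qed
  have "Q \<rho> x \<longleftrightarrow> sat M \<psi> ((env \<rho> \<sigma>)(k := x))" if "\<forall>i. \<rho> i \<in> M" "x \<in> M" for \<rho> x
  proof -
    have "\<forall>i. (case_nat x \<rho>) i \<in> M"
      using that by (auto split: nat.split)
    from \<phi>[OF this] show ?thesis by (simp add: eq)
  qed
  then show ?thesis
    unfolding definable_def using \<sigma> by (intro exI[of _ "Ex k \<psi>"] exI[of _ \<sigma>]) simp
qed

lemma definable_all:
  assumes "definable M (\<lambda>\<rho>. Q (\<lambda>n. \<rho> (Suc n)) (\<rho> 0))"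
  shows "definable M (\<lambda>\<rho>. \<forall>x\<in>M. Q \<rho> x)"
proof -
  have "definable M (\<lambda>\<rho>. \<not> (\<exists>x\<in>M. \<not> Q \<rho> x))"
    by (rule definable_neg, rule definable_ex, rule definable_neg, rule assms)
  then show ?thesis by simp
qed

lemma definable_or:
  assumes "definable M A" "definable M B"
  shows "definable M (\<lambda>\<rho>. A \<rho> \<or> B \<rho>)"
proof -
  have "definable M (\<lambda>\<rho>. \<not> (\<not> A \<rho> \<and> \<not> B \<rho>))"
    by (rule definable_neg, rule definable_and; rule definable_neg, rule assms)
  then show ?thesis by simp
qed

lemma definable_imp:
  assumes "definable M A" "definable M B"
  shows "definable M (\<lambda>\<rho>. A \<rho> \<longrightarrow> B \<rho>)"
proof -
  have "definable M (\<lambda>\<rho>. \<not> A \<rho> \<or> B \<rho>)"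
    by (rule definable_or, rule definable_neg, rule assms, rule assms)
  then show ?thesis by (rule definable_cong) blast
qed

lemma definable_iff:
  assumes "definable M A" "definable M B"
  shows "definable M (\<lambda>\<rho>. A \<rho> \<longleftrightarrow> B \<rho>)"
proof -
  have "definable M (\<lambda>\<rho>. (A \<rho> \<longrightarrow> B \<rho>) \<and> (B \<rho> \<longrightarrow> A \<rho>))"
    by (rule definable_and; rule definable_imp; rule assms)
  then show ?thesis by (rule definable_cong) blast
qed

lemma definable_term_closed: "definable_term M t \<Longrightarrow> \<forall>i. \<rho> i \<in> M \<Longrightarrow> t \<rho> \<in> M"
  by (simp add: definable_term_def)

lemma definable_mem_var: "x \<in> M \<Longrightarrow> definable M (\<lambda>\<rho>. \<rho> k \<in> elts (\<rho> l))"
  by (rule definableI[where \<sigma> = "\<lambda>_. x" and \<phi> = "Mem k l" and g = Inl]) auto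

lemma definable_eq_var: "x \<in> M \<Longrightarrow> definable M (\<lambda>\<rho>. \<rho> k = \<rho> l)"
  by (rule definableI[where \<sigma> = "\<lambda>_. x" and \<phi> = "Eq k l" and g = Inl]) auto

lemma definable_term_const: "c \<in> M \<Longrightarrow> definable_term M (\<lambda>\<rho>. c)"
  unfolding definable_term_def
  by (intro conjI definableI[where \<sigma> = "\<lambda>_. c" and \<phi> = "Eq 0 1" and g = "\<lambda>n. if n = 0 then Inl 0 else Inr 0"])
    auto

lemma definable_term_rename: "definable_term M t \<Longrightarrow> definable_term M (\<lambda>\<rho>. t (\<lambda>n. \<rho> (f n)))"
proof -
  assume t: "definable_term M t"
  then have "definable M (\<lambda>\<rho>. \<rho> 0 = t (\<lambda>n. \<rho> (Suc n)))" by (simp add: definable_term_def)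
  from definable_rename[OF this, of "case_nat 0 (\<lambda>n. Suc (f n))"] t
  show ?thesis by (auto simp: definable_term_def)
qed

text \<open>The value is introduced by a quantifier: some x in M equals \<open>t \<rho>\<close> and
  satisfies \<open>Q\<close>. The graph of \<open>t\<close> is definable, and its value lies in M,
  so the witness exists.\<close>

lemma definable_subst:
  assumes t: "definable_term M t" and Q: "definable M (\<lambda>\<rho>. Q (\<lambda>n. \<rho> (Suc n)) (\<rho> 0))"
  shows "definable M (\<lambda>\<rho>. Q \<rho> (t \<rho>))"
proof -
  have "definable M (\<lambda>\<rho>. \<exists>x\<in>M. x = t \<rho> \<and> Q \<rho> x)"
    using t Q by (intro definable_ex definable_and) (simp_all add: definable_term_def)
  moreover have "(\<exists>x\<in>M. x = t \<rho> \<and> Q \<rho> x) \<longleftrightarrow> Q \<rho> (t \<rho>)" if "\<forall>i. \<rho> i \<in> M" for \<rho>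
    using definable_term_closed[OF t that] by auto
  ultimately show ?thesis by (rule definable_cong)
qed

section \<open>Closure of a transitive model under definable set operations\<close>

locale transitive_model =
  fixes M :: "hc set"
  assumes ctm: "ctm_ZFC M"
begin

lemma M_trans: "x \<in> elts y \<Longrightarrow> y \<in> M \<Longrightarrow> x \<in> M"
  using ctm unfolding ctm_ZFC_def by blast

lemma M_nonempty: "\<exists>x. x \<in> M"
  using ctm unfolding ctm_ZFC_def models_ZFC_def ax_infinity_def by blast

lemma opair_components_in_M:
  assumes "opair x y \<in> M"
  shows "x \<in> M" "y \<in> M"
proof -
  have "mk {x, y} \<in> elts (opair x y)" by (simp add: opair_def)
  then have "mk {x, y} \<in> M" using assms M_trans by blast
  then show "x \<in> M" "y \<in> M" by (auto intro: M_trans[of _ "mk {x, y}"])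
qed

lemma opair_mem_in_M:
  assumes "opair x y \<in> elts z" "z \<in> M"
  shows "x \<in> M" "y \<in> M"
  using opair_components_in_M M_trans[OF assms] by blast+

lemma vdom_in_M: "x \<in> vdom z \<Longrightarrow> z \<in> M \<Longrightarrow> x \<in> M"
  using opair_mem_in_M by (auto simp: vdom_def)

lemma pair_in_M:
  assumes "x \<in> M" "y \<in> M"
  shows "mk {x, y} \<in> M"
proof -
  have "ax_pairing M" using ctm by (simp add: ctm_ZFC_def models_ZFC_def)
  with assms obtain z where z: "z \<in> M" "\<forall>w\<in>M. w \<in> elts z \<longleftrightarrow> w = x \<or> w = y"
    unfolding ax_pairing_def by blast
  then have "elts z = {x, y}" using assms M_trans by blast
  then have "z = mk {x, y}" by (simp flip: elts_inject)
  with z show ?thesis by simp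
qed

lemma opair_in_M: "x \<in> M \<Longrightarrow> y \<in> M \<Longrightarrow> opair x y \<in> M"
  unfolding opair_def using pair_in_M pair_in_M[of x x] by simp

lemma Union_in_M:
  assumes "x \<in> M"
  shows "mk (\<Union>y\<in>elts x. elts y) \<in> M"
proof -
  have "ax_union M" using ctm by (simp add: ctm_ZFC_def models_ZFC_def)
  with assms obtain u where u: "u \<in> M"
    "\<forall>w\<in>M. w \<in> elts u \<longleftrightarrow> (\<exists>y\<in>M. y \<in> elts x \<and> w \<in> elts y)"
    unfolding ax_union_def by blast
  then have "elts u = (\<Union>y\<in>elts x. elts y)" using assms M_trans by blast
  then have "u = mk (\<Union>y\<in>elts x. elts y)" by (simp flip: elts_inject)
  with u show ?thesis by simp
qed

lemma separation_in_M:
  assumes Q: "definable M (\<lambda>\<rho>. Q (\<lambda>n. \<rho> (Suc n)) (\<rho> 0))" and "x \<in> M" "\<forall>i. \<rho> i \<in> M"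
  shows "mk {w \<in> elts x. Q \<rho> w} \<in> M"
proof -
  obtain \<phi> \<sigma> where \<sigma>: "\<forall>i. \<sigma> i \<in> M"
    and \<phi>: "\<And>\<rho>. \<forall>i. \<rho> i \<in> M \<Longrightarrow> Q (\<lambda>n. \<rho> (Suc n)) (\<rho> 0) \<longleftrightarrow> sat M \<phi> (env \<rho> \<sigma>)"
    using Q unfolding definable_def by blast
  have \<rho>': "\<forall>i. (case_nat w \<rho>) i \<in> M" if "w \<in> M" for w
    using that assms by (auto split: nat.split)
  \<comment> \<open>Separation updates one variable of a fixed assignment. The slot of argument 0
    holds \<open>x\<close> as a placeholder until \<open>w\<close> overwrites it.\<close>
  have range: "range (env (case_nat x \<rho>) \<sigma>) \<subseteq> M"
    using \<rho>'[OF \<open>x \<in> M\<close>] \<sigma> unfolding env_def by (auto split: sum.split)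
  have "ax_separation M" using ctm by (simp add: ctm_ZFC_def models_ZFC_def)
  note this[unfolded ax_separation_def, THEN spec[where x = \<phi>], THEN spec[where x = "sum_encode (Inl 0)"],
      THEN spec[where x = "env (case_nat x \<rho>) \<sigma>"], THEN mp[OF _ range], THEN bspec[OF _ \<open>x \<in> M\<close>]]
  then obtain u where u: "u \<in> M" "\<forall>w\<in>M. w \<in> elts u \<longleftrightarrow>
      w \<in> elts x \<and> sat M \<phi> ((env (case_nat x \<rho>) \<sigma>)(sum_encode (Inl 0) := w))"
    by blast
  have "(env (case_nat x \<rho>) \<sigma>)(sum_encode (Inl 0) := w) = env (case_nat w \<rho>) \<sigma>" for w
    by (auto simp: env_def fun_eq_iff split: sum.split nat.split)
      (metis sum_decode_inverse)
  then have "w \<in> elts u \<longleftrightarrow> w \<in> elts x \<and> Q \<rho> w" if "w \<in> M" for w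
    using u(2) \<phi>[OF \<rho>'[OF that]] that by simp
  then have "elts u = {w \<in> elts x. Q \<rho> w}" using u(1) \<open>x \<in> M\<close> M_trans by blast
  moreover have "countable {w \<in> elts x. Q \<rho> w}"
    by (rule countable_subset[OF _ countable_elts[of x]]) blast
  ultimately have "u = mk {w \<in> elts x. Q \<rho> w}" by (simp flip: elts_inject)
  with u show ?thesis by simp
qed

text \<open>Replacement is applied to the formula for the graph of \<open>s \<rho>\<close>. As
  \<open>s \<rho>\<close> is total on M, existence and uniqueness of the value are immediate;
  transitivity of M makes the resulting set the true image.\<close>

lemma replacement_in_M:
  assumes s: "definable_term M (\<lambda>\<rho>. s (\<lambda>n. \<rho> (Suc n)) (\<rho> 0))" and "x \<in> M" "\<forall>i. \<rho> i \<in> M"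
  shows "mk (s \<rho> ` elts x) \<in> M"
proof -
  obtain \<phi> \<sigma> where \<sigma>: "\<forall>i. \<sigma> i \<in> M"
    and \<phi>: "\<And>\<rho>. \<forall>i. \<rho> i \<in> M \<Longrightarrow>
      \<rho> 0 = s (\<lambda>n. \<rho> (Suc (Suc n))) (\<rho> (Suc 0)) \<longleftrightarrow> sat M \<phi> (env \<rho> \<sigma>)"
    using s unfolding definable_term_def definable_def by blast
  have \<rho>': "\<forall>i. (case_nat w \<rho>') i \<in> M" if "w \<in> M" "\<forall>i. \<rho>' i \<in> M" for w \<rho>'
    using that by (auto split: nat.split)
  have s_in: "s \<rho> w \<in> M" if "w \<in> M" for w
    using definable_term_closed[OF s \<rho>'[OF that assms(3)]] by simp
  let ?E = "\<lambda>v w. env (case_nat v (case_nat w \<rho>)) \<sigma>"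
  let ?k = "sum_encode (Inl 1)" and ?l = "sum_encode (Inl 0)"
  have E: "(?E x x)(?k := w, ?l := v) = ?E v w" for v w
  proof
    fix n
    obtain z where z: "n = sum_encode z" by (metis sum_decode_inverse)
    show "((?E x x)(?k := w, ?l := v)) n = ?E v w n"
      unfolding z by (auto simp: env_def sum_encode_eq split: sum.split nat.split)
  qed
  have sat: "sat M \<phi> (?E v w) \<longleftrightarrow> v = s \<rho> w" if "v \<in> M" "w \<in> M" for v w
    using \<phi>[OF \<rho>'[OF that(1) \<rho>'[OF that(2) assms(3)]]] by simp
  have range: "range (?E x x) \<subseteq> M"
    using \<rho>'[OF \<open>x \<in> M\<close> \<rho>'[OF \<open>x \<in> M\<close> assms(3)]] \<sigma> unfolding env_def by (auto split: sum.split)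
  have "?k \<noteq> ?l" by (simp add: sum_encode_eq)
  have "ax_replacement M" using ctm by (simp add: ctm_ZFC_def models_ZFC_def)
  note R = this[unfolded ax_replacement_def, THEN spec[where x = \<phi>], THEN spec[where x = ?k],
      THEN spec[where x = ?l], THEN spec[where x = "?E x x"], THEN mp[OF _ \<open>?k \<noteq> ?l\<close>],
      THEN mp[OF _ range], THEN bspec[OF _ \<open>x \<in> M\<close>], unfolded E]
  have "\<exists>!v. v \<in> M \<and> sat M \<phi> (?E v w)" if "w \<in> M" for w
    using s_in[OF that] sat[OF _ that] by auto
  then have "\<exists>u\<in>M. \<forall>v\<in>M. v \<in> elts u \<longleftrightarrow> (\<exists>w\<in>M. w \<in> elts x \<and> sat M \<phi> (?E v w))"
    by (intro R[THEN mp]) blast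
  then obtain u where u: "u \<in> M"
    and u_iff: "\<forall>v\<in>M. v \<in> elts u \<longleftrightarrow> (\<exists>w\<in>M. w \<in> elts x \<and> sat M \<phi> (?E v w))"
    by (rule bexE)
  have "elts u = s \<rho> ` elts x"
  proof (rule set_eqI)
    fix v
    show "v \<in> elts u \<longleftrightarrow> v \<in> s \<rho> ` elts x"
    proof (cases "v \<in> M")
      case True
      have "(\<exists>w\<in>M. w \<in> elts x \<and> sat M \<phi> (?E v w)) \<longleftrightarrow> (\<exists>w\<in>elts x. v = s \<rho> w)"
        using sat[OF True] M_trans[OF _ \<open>x \<in> M\<close>] by auto
      with u_iff True show ?thesis by (simp add: image_iff)
    next
      case False
      then show ?thesis using M_trans[OF _ u] s_in M_trans[OF _ \<open>x \<in> M\<close>] by auto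
    qed
  qed
  then have "u = mk (s \<rho> ` elts x)" by (simp flip: elts_inject)
  with u show ?thesis by simp
qed

lemma definable_term_var: "definable_term M (\<lambda>\<rho>. \<rho> k)"
  using M_nonempty definable_eq_var unfolding definable_term_def by blast

lemma definable_mem:
  assumes "definable_term M t" "definable_term M s"
  shows "definable M (\<lambda>\<rho>. t \<rho> \<in> elts (s \<rho>))"
proof -
  have "definable M (\<lambda>\<rho>. \<rho> (Suc 0) \<in> elts (\<rho> 0))"
    using M_nonempty definable_mem_var by blast
  then have "definable M (\<lambda>\<rho>. \<rho> 0 \<in> elts (s (\<lambda>n. \<rho> (Suc n))))"
    by (rule definable_subst[OF definable_term_rename[OF assms(2)], where Q = "\<lambda>\<rho> a. \<rho> 0 \<in> elts a"])
  then show ?thesis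
    by (rule definable_subst[OF assms(1), where Q = "\<lambda>\<rho> a. a \<in> elts (s \<rho>)"])
qed

lemma definable_eq:
  assumes "definable_term M t" "definable_term M s"
  shows "definable M (\<lambda>\<rho>. t \<rho> = s \<rho>)"
  using assms(2) by (intro definable_subst[OF assms(1), where Q = "\<lambda>\<rho> a. a = s \<rho>"]) (simp add:
        definable_term_def)

lemma definable_bex:
  assumes "definable_term M t" "definable M (\<lambda>\<rho>. Q (\<lambda>n. \<rho> (Suc n)) (\<rho> 0))"
  shows "definable M (\<lambda>\<rho>. \<exists>x\<in>elts (t \<rho>). Q \<rho> x)"
proof -
  have "definable M (\<lambda>\<rho>. \<exists>x\<in>M. x \<in> elts (t \<rho>) \<and> Q \<rho> x)"
    by (intro definable_ex definable_and definable_mem definable_term_var assms(1)[THEN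
        definable_term_rename] assms(2))
  moreover have "(\<exists>x\<in>M. x \<in> elts (t \<rho>) \<and> Q \<rho> x) \<longleftrightarrow> (\<exists>x\<in>elts (t \<rho>). Q \<rho> x)" if "\<forall>i. \<rho> i \<in> M" for \<rho>
    using definable_term_closed[OF assms(1) that] M_trans by blast
  ultimately show ?thesis by (rule definable_cong)
qed

lemma definable_ball:
  assumes "definable_term M t" "definable M (\<lambda>\<rho>. Q (\<lambda>n. \<rho> (Suc n)) (\<rho> 0))"
  shows "definable M (\<lambda>\<rho>. \<forall>x\<in>elts (t \<rho>). Q \<rho> x)"
proof -
  have "definable M (\<lambda>\<rho>. \<not> (\<exists>x\<in>elts (t \<rho>). \<not> Q \<rho> x))"
    by (rule definable_neg, rule definable_bex, rule assms, rule definable_neg, rule assms)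
  then show ?thesis by simp
qed

text \<open>By extensionality an equation \<open>y = t \<rho>\<close> says that
  \<open>x \<in> elts y\<close> iff \<open>A \<rho> x\<close>, for all x in M. Both sets lie in the
  transitive M, so agreement on M is true equality. The set operations below reduce to this
  rule.\<close>

lemma definable_term_set:
  assumes "\<And>\<rho>. \<forall>i. \<rho> i \<in> M \<Longrightarrow> t \<rho> \<in> M"
    and "\<And>\<rho> x. \<forall>i. \<rho> i \<in> M \<Longrightarrow> x \<in> M \<Longrightarrow> x \<in> elts (t \<rho>) \<longleftrightarrow> A \<rho> x"
    and "definable M (\<lambda>\<rho>. A (\<lambda>n. \<rho> (Suc n)) (\<rho> 0))"
  shows "definable_term M t"
proof -
  have "definable M (\<lambda>\<rho>. \<forall>x\<in>M. x \<in> elts (\<rho> 0) \<longleftrightarrow> A (\<lambda>n. \<rho> (Suc n)) x)"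
    using definable_rename[OF assms(3), of "case_nat 0 (\<lambda>n. Suc (Suc n))"]
    by (intro definable_all definable_iff definable_mem definable_term_var) simp
  moreover have "(\<forall>x\<in>M. x \<in> elts (\<rho> 0) \<longleftrightarrow> A (\<lambda>n. \<rho> (Suc n)) x) \<longleftrightarrow> \<rho> 0 = t (\<lambda>n. \<rho> (Suc n))"
    if "\<forall>i. \<rho> i \<in> M" for \<rho>
  proof -
    let ?\<sigma> = "\<lambda>n. \<rho> (Suc n)"
    have \<sigma>: "\<forall>i. ?\<sigma> i \<in> M" and 0: "\<rho> 0 \<in> M" using that by auto
    have "(\<forall>x\<in>M. x \<in> elts (\<rho> 0) \<longleftrightarrow> A ?\<sigma> x) \<longleftrightarrow> (\<forall>x\<in>M. x \<in> elts (\<rho> 0) \<longleftrightarrow> x \<in> elts (t ?\<sigma>))"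
      using assms(2)[OF \<sigma>] by blast
    also have "\<dots> \<longleftrightarrow> elts (\<rho> 0) = elts (t ?\<sigma>)"
      using M_trans[OF _ 0] M_trans[OF _ assms(1)[OF \<sigma>]] by blast
    finally show ?thesis by (simp add: elts_inject)
  qed
  ultimately have "definable M (\<lambda>\<rho>. \<rho> 0 = t (\<lambda>n. \<rho> (Suc n)))"
    by (rule definable_cong)
  with assms(1) show ?thesis by (simp add: definable_term_def)
qed

lemma definable_term_Collect:
  assumes "definable_term M t" "definable M (\<lambda>\<rho>. Q (\<lambda>n. \<rho> (Suc n)) (\<rho> 0))"
  shows "definable_term M (\<lambda>\<rho>. mk {x \<in> elts (t \<rho>). Q \<rho> x})"
proof (rule definable_term_set[where A = "\<lambda>\<rho> x. x \<in> elts (t \<rho>) \<and> Q \<rho> x"])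
  show "mk {x \<in> elts (t \<rho>). Q \<rho> x} \<in> M" if "\<forall>i. \<rho> i \<in> M" for \<rho>
    by (rule separation_in_M[where Q = Q, OF assms(2) definable_term_closed[OF assms(1) that] that])
  have "countable {x \<in> elts (t \<rho>). Q \<rho> x}" for \<rho>
    by (rule countable_subset[OF _ countable_elts[of "t \<rho>"]]) blast
  then show "x \<in> elts (mk {x \<in> elts (t \<rho>). Q \<rho> x}) \<longleftrightarrow> x \<in> elts (t \<rho>) \<and> Q \<rho> x" for \<rho> x
    by simp
  show "definable M (\<lambda>\<rho>. \<rho> 0 \<in> elts (t (\<lambda>n. \<rho> (Suc n))) \<and> Q (\<lambda>n. \<rho> (Suc n)) (\<rho> 0))"
    by (intro definable_and definable_mem definable_term_var assms(1)[THEN definable_term_rename]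
        assms(2))
qed

lemma definable_term_image:
  assumes "definable_term M t" "definable_term M (\<lambda>\<rho>. s (\<lambda>n. \<rho> (Suc n)) (\<rho> 0))"
  shows "definable_term M (\<lambda>\<rho>. mk (s \<rho> ` elts (t \<rho>)))"
proof (rule definable_term_set[where A = "\<lambda>\<rho> x. \<exists>w\<in>elts (t \<rho>). x = s \<rho> w"])
  show "mk (s \<rho> ` elts (t \<rho>)) \<in> M" if "\<forall>i. \<rho> i \<in> M" for \<rho>
    by (rule replacement_in_M[where s = s, OF assms(2) definable_term_closed[OF assms(1) that] that])
  show "x \<in> elts (mk (s \<rho> ` elts (t \<rho>))) \<longleftrightarrow> (\<exists>w\<in>elts (t \<rho>). x = s \<rho> w)" for \<rho> x
    by auto
  have "definable_term M (\<lambda>\<rho>. s (\<lambda>n. \<rho> (Suc (Suc n))) (\<rho> 0))"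
    using definable_term_rename[OF assms(2), of "case_nat 0 (\<lambda>n. Suc (Suc n))"] by simp
  then show "definable M (\<lambda>\<rho>. \<exists>w\<in>elts (t (\<lambda>n. \<rho> (Suc n))). \<rho> 0 = s (\<lambda>n. \<rho> (Suc n)) w)"
    by (intro definable_bex definable_eq definable_term_var assms(1)[THEN definable_term_rename])
qed

lemma definable_term_Union:
  assumes "definable_term M t"
  shows "definable_term M (\<lambda>\<rho>. mk (\<Union>y\<in>elts (t \<rho>). elts y))"
proof (rule definable_term_set[where A = "\<lambda>\<rho> x. \<exists>y\<in>elts (t \<rho>). x \<in> elts y"])
  show "mk (\<Union>y\<in>elts (t \<rho>). elts y) \<in> M" if "\<forall>i. \<rho> i \<in> M" for \<rho>
    by (rule Union_in_M[OF definable_term_closed[OF assms that]])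
  show "definable M (\<lambda>\<rho>. \<exists>y\<in>elts (t (\<lambda>n. \<rho> (Suc n))). \<rho> 0 \<in> elts y)"
    by (intro definable_bex definable_mem definable_term_var assms[THEN definable_term_rename])
qed simp

lemma definable_term_UN:
  assumes "definable_term M t" "definable_term M (\<lambda>\<rho>. s (\<lambda>n. \<rho> (Suc n)) (\<rho> 0))"
  shows "definable_term M (\<lambda>\<rho>. mk (\<Union>x\<in>elts (t \<rho>). elts (s \<rho> x)))"
  using definable_term_Union[OF definable_term_image[OF assms]] by simp

lemma definable_term_pair:
  assumes "definable_term M t" "definable_term M s"
  shows "definable_term M (\<lambda>\<rho>. mk {t \<rho>, s \<rho>})"
proof (rule definable_term_set[where A = "\<lambda>\<rho> x. x = t \<rho> \<or> x = s \<rho>"])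
  show "mk {t \<rho>, s \<rho>} \<in> M" if "\<forall>i. \<rho> i \<in> M" for \<rho>
    by (rule pair_in_M[OF assms[THEN definable_term_closed, OF that]])
  show "definable M (\<lambda>\<rho>. \<rho> 0 = t (\<lambda>n. \<rho> (Suc n)) \<or> \<rho> 0 = s (\<lambda>n. \<rho> (Suc n)))"
    by (intro definable_or definable_eq definable_term_var assms[THEN definable_term_rename])
qed simp

lemma definable_term_opair:
  assumes "definable_term M t" "definable_term M s"
  shows "definable_term M (\<lambda>\<rho>. opair (t \<rho>) (s \<rho>))"
  using definable_term_pair[OF definable_term_pair[OF assms(1) assms(1)] definable_term_pair[OF assms]]
  by (simp add: opair_def)

lemma definable_term_Un:
  assumes "definable_term M t" "definable_term M s"
  shows "definable_term M (\<lambda>\<rho>. mk (elts (t \<rho>) \<union> elts (s \<rho>)))"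
  using definable_term_Union[OF definable_term_pair[OF assms]] by simp

lemma definable_term_vsucc: "definable_term M t \<Longrightarrow> definable_term M (\<lambda>\<rho>. vsucc (t \<rho>))"
  using definable_term_Un[OF definable_term_pair, of t t t] by (simp add: vsucc_def)

end

section \<open>Recursion along the domain of a name\<close>

lemma vdom_induct: "(\<And>x. (\<And>y. y \<in> vdom x \<Longrightarrow> Q y) \<Longrightarrow> Q x) \<Longrightarrow> Q x"
  by (rule wf_induct_rule[OF wf_mem_trancl]) (blast intro: vdom_mem)

text \<open>The double union contains both components of every Kuratowski pair in \<open>x\<close>.
  It bounds the quantifiers over pairs, so that domains and applications become definable, and it
  shows that domains and sets of values are countable.\<close>

definition Union2 :: "hc \<Rightarrow> hc" where
  "Union2 x = mk (\<Union>y\<in>elts (mk (\<Union>y\<in>elts x. elts y)). elts y)"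

lemma opair_components_mem_Union2:
  assumes "opair y z \<in> elts x"
  shows "y \<in> elts (Union2 x)" "z \<in> elts (Union2 x)"
proof -
  have "mk {y, z} \<in> elts (opair y z)" by (simp add: opair_def)
  moreover have "y \<in> elts (mk {y, z})" "z \<in> elts (mk {y, z})" by simp_all
  ultimately show "y \<in> elts (Union2 x)" "z \<in> elts (Union2 x)"
    using assms unfolding Union2_def by (simp, blast)+
qed

lemma countable_vdom [simp]: "countable (vdom x)"
  by (rule countable_subset[OF _ countable_elts[of "Union2 x"]])
    (auto simp: vdom_def intro: opair_components_mem_Union2)

lemma countable_values [simp]: "countable {z. opair y z \<in> elts x}"
  by (rule countable_subset[OF _ countable_elts[of "Union2 x"]])
    (auto intro: opair_components_mem_Union2)

text \<open>Function application without a choice operator: it agrees with \<open>app\<close> on functions and is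
  definable everywhere.\<close>

definition fapp :: "hc \<Rightarrow> hc \<Rightarrow> hc" where
  "fapp f x = mk (\<Union>z\<in>{z. opair x z \<in> elts f}. elts z)"

lemma elts_fapp: "elts (fapp f x) = (\<Union>z\<in>{z. opair x z \<in> elts f}. elts z)"
  unfolding fapp_def by (rule elts_mk) simp

lemma fapp_graph: "countable A \<Longrightarrow> x \<in> A \<Longrightarrow> fapp (mk ((\<lambda>y. opair y (g y)) ` A)) x = g x"
  by (rule elts_inject[THEN iffD1]) (auto simp: elts_fapp)

context transitive_model
begin

lemma Un_in_M: "x \<in> M \<Longrightarrow> y \<in> M \<Longrightarrow> mk (elts x \<union> elts y) \<in> M"
  using Union_in_M[OF pair_in_M, of x y] by simp

lemma definable_term_Union2: "definable_term M t \<Longrightarrow> definable_term M (\<lambda>\<rho>. Union2 (t \<rho>))"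
  unfolding Union2_def by (intro definable_term_Union)

lemma definable_term_vdom:
  assumes t: "definable_term M t"
  shows "definable_term M (\<lambda>\<rho>. mk (vdom (t \<rho>)))"
proof -
  have "vdom x = {y \<in> elts (Union2 x). \<exists>z\<in>elts (Union2 x). opair y z \<in> elts x}" for x
    by (auto simp: vdom_def intro: opair_components_mem_Union2)
  moreover have "definable_term M (\<lambda>\<rho>. mk {y \<in> elts (Union2 (t \<rho>)). \<exists>z\<in>elts (Union2 (t \<rho>)). opair y z \<in> elts (t \<rho>)})"
    by (intro definable_term_Collect definable_term_Union2 definable_bex definable_mem
        definable_term_opair definable_term_var t t[THEN definable_term_rename])
  ultimately show ?thesis by simp
qed

lemma definable_mem_vdom: "definable_term M t \<Longrightarrow> definable_term M s \<Longrightarrow> definable M (\<lambda>\<rho>. t \<rho> \<in> vdom (s \<rho>))"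
  using definable_mem[OF _ definable_term_vdom, of t s] by simp

lemma definable_bex_vdom:
  "definable_term M t \<Longrightarrow> definable M (\<lambda>\<rho>. Q (\<lambda>n. \<rho> (Suc n)) (\<rho> 0)) \<Longrightarrow> definable M (\<lambda>\<rho>. \<exists>x\<in>vdom (t \<rho>). Q \<rho> x)"
  using definable_bex[OF definable_term_vdom, of t Q] by simp

lemma definable_ball_vdom:
  "definable_term M t \<Longrightarrow> definable M (\<lambda>\<rho>. Q (\<lambda>n. \<rho> (Suc n)) (\<rho> 0)) \<Longrightarrow> definable M (\<lambda>\<rho>. \<forall>x\<in>vdom (t \<rho>). Q \<rho> x)"
  using definable_ball[OF definable_term_vdom, of t Q] by simp

lemma definable_term_image_vdom:
  "definable_term M t \<Longrightarrow> definable_term M (\<lambda>\<rho>. s (\<lambda>n. \<rho> (Suc n)) (\<rho> 0)) \<Longrightarrow> definable_term M (\<lambda>\<rho>. mk (s \<rho> ` vdom (t \<rho>)))"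
  using definable_term_image[OF definable_term_vdom, of t s] by simp

lemma definable_term_UN_vdom:
  "definable_term M t \<Longrightarrow> definable_term M (\<lambda>\<rho>. s (\<lambda>n. \<rho> (Suc n)) (\<rho> 0)) \<Longrightarrow>
    definable_term M (\<lambda>\<rho>. mk (\<Union>x\<in>vdom (t \<rho>). elts (s \<rho> x)))"
  using definable_term_UN[OF definable_term_vdom, of t s] by simp

lemma definable_term_fapp:
  assumes t: "definable_term M t" and s: "definable_term M s"
  shows "definable_term M (\<lambda>\<rho>. fapp (t \<rho>) (s \<rho>))"
proof -
  have "fapp f x = mk {a \<in> elts (mk (\<Union>z\<in>elts (Union2 f). elts z)).
      \<exists>z\<in>elts (Union2 f). opair x z \<in> elts f \<and> a \<in> elts z}" for f x
    unfolding fapp_def by (rule arg_cong[where f = mk]) (auto intro: opair_components_mem_Union2)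
  moreover have "definable_term M (\<lambda>\<rho>. mk {a \<in> elts (mk (\<Union>z\<in>elts (Union2 (t \<rho>)). elts z)).
      \<exists>z\<in>elts (Union2 (t \<rho>)). opair (s \<rho>) z \<in> elts (t \<rho>) \<and> a \<in> elts z})"
    by (intro definable_term_Collect definable_term_Union definable_term_Union2 definable_bex
        definable_and definable_mem definable_term_opair definable_term_var
        t t[THEN definable_term_rename] s[THEN definable_term_rename])
  ultimately show ?thesis by simp
qed

text \<open>For \<open>y \<in> M\<close> there is a least approximation to the graph of \<open>F\<close> whose domain contains \<open>y\<close> and is closed
  under \<open>vdom\<close>.  Being unique it is a definable function of \<open>y\<close>, so that Replacement collects the
  approximations for all elements of \<open>vdom y\<close>.\<close>

lemma recursion_in_M:
  fixes F :: "hc \<Rightarrow> hc"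
  assumes H: "\<And>t s. definable_term M t \<Longrightarrow> definable_term M s \<Longrightarrow> definable_term M (\<lambda>\<rho>. H (t \<rho>) (s \<rho>))"
    and F: "\<And>x. F x = H x (mk ((\<lambda>y. opair y (F y)) ` vdom x))"
    and "x \<in> M"
  shows "F x \<in> M"
proof -
  let ?p = "\<lambda>y. opair y (F y)"
  \<comment> \<open>This cuts f down to \<open>vdom y\<close>, the form in which \<open>H\<close>
    receives the values already computed.\<close>
  define restr where "restr f y = mk {w \<in> elts f. \<exists>z\<in>vdom y. \<exists>v\<in>M. w = opair z v}" for f y
  define good where "good f \<longleftrightarrow> (\<forall>w\<in>elts f. \<exists>y\<in>M. \<exists>v\<in>M. w = opair y v \<and>
    v = H y (restr f y) \<and> (\<forall>z\<in>vdom y. z \<in> vdom f))" for f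
  \<comment> \<open>\<open>good\<close> does not mention \<open>F\<close> and is therefore
    definable; \<open>approx\<close> says that f is a piece of the graph of \<open>F\<close> with
    closed domain, which is what the arguments use. For f in M the two notions agree.\<close>
  define approx where "approx f D \<longleftrightarrow> elts f = ?p ` D \<and> (\<forall>y\<in>D. vdom y \<subseteq> D)" for f D
  define least where "least y f \<longleftrightarrow> good f \<and> y \<in> vdom f \<and>
    (\<forall>g\<in>M. good g \<and> y \<in> vdom g \<longrightarrow> (\<forall>w\<in>elts f. w \<in> elts g))" for y f
  \<comment> \<open>The default \<open>y\<close> keeps \<open>G\<close> total with values in M. It
    must be a definable term before existence of least approximations is known, since the existence
    proof itself applies Replacement to \<open>G\<close>.\<close>
  define G where "G y = (if \<exists>f\<in>M. least y f then THE f. f \<in> M \<and> least y f else y)" for y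

  have restr_definable_term: "definable_term M (\<lambda>\<rho>. restr (t \<rho>) (s \<rho>))"
    if t: "definable_term M t" and s: "definable_term M s" for t s
    unfolding restr_def
    by (intro definable_term_Collect definable_bex_vdom definable_ex definable_eq
        definable_term_opair definable_term_var t s[THEN definable_term_rename])
  have good_definable: "definable M (\<lambda>\<rho>. good (t \<rho>))" if t: "definable_term M t" for t
    unfolding good_def
    by (intro definable_ball definable_ex definable_and definable_eq definable_term_opair
        definable_ball_vdom definable_mem_vdom H restr_definable_term
        definable_term_var t t[THEN definable_term_rename])
  have least_definable: "definable M (\<lambda>\<rho>. least (t \<rho>) (s \<rho>))"
    if t: "definable_term M t" and s: "definable_term M s" for t s
    unfolding least_def
    by (intro definable_and good_definable definable_mem_vdom definable_all definable_imp
        definable_ball definable_mem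
        definable_term_var t s t[THEN definable_term_rename] s[THEN definable_term_rename])

  have vdom_approx: "vdom f = D" if "approx f D" for f D
    using that unfolding approx_def vdom_def by auto
  have restr_approx: "restr f y = mk (?p ` vdom y)"
    if "f \<in> M" "approx f D" "vdom y \<subseteq> D" for f D y
  proof -
    have "F z \<in> M" if "z \<in> D" for z
      using opair_mem_in_M(2)[of z "F z" f] that \<open>f \<in> M\<close> \<open>approx f D\<close> by (simp add: approx_def)
    then have "{w \<in> elts f. \<exists>z\<in>vdom y. \<exists>v\<in>M. w = opair z v} = ?p ` vdom y"
      using that unfolding approx_def by auto
    then show ?thesis by (simp add: restr_def)
  qed
  have good_if_approx: "good f" if f: "f \<in> M" and D: "approx f D" for f D
    unfolding good_def
  proof
    fix w assume w: "w \<in> elts f"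
    with D obtain y where y: "w = ?p y" "y \<in> D" by (auto simp: approx_def)
    have "vdom y \<subseteq> D" using D y by (auto simp: approx_def)
    with f D y w show "\<exists>y\<in>M. \<exists>v\<in>M. w = opair y v \<and> v = H y (restr f y) \<and> (\<forall>z\<in>vdom y. z \<in> vdom f)"
      using opair_mem_in_M[of y "F y" f] F[of y]
      by (auto simp: restr_approx[OF f D] vdom_approx[OF D])
  qed
  have approx_if_good: "approx f (vdom f)" if f: "f \<in> M" and good: "good f" for f
  proof -
    \<comment> \<open>A good f has no freedom: by induction it agrees with \<open>F\<close> on
      \<open>vdom y\<close>, so \<open>H\<close> is applied to the true restricted graph.\<close>
    have val: "v = F y" if "opair y v \<in> elts f" for y v
      using that
    proof (induction y arbitrary: v rule: vdom_induct)
      case (1 y)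
      from good 1(2) have v: "v = H y (restr f y)" and sub: "\<forall>z\<in>vdom y. z \<in> vdom f"
        unfolding good_def by fastforce+
      have "{w \<in> elts f. \<exists>z\<in>vdom y. \<exists>v\<in>M. w = opair z v} = ?p ` vdom y"
      proof (intro set_eqI iffI)
        fix w assume "w \<in> ?p ` vdom y"
        then obtain z where z: "z \<in> vdom y" "w = ?p z" by blast
        with sub obtain v' where "opair z v' \<in> elts f" by (auto simp: vdom_def)
        moreover from this have "v' = F z" by (rule 1(1)[OF z(1)])
        ultimately show "w \<in> {w \<in> elts f. \<exists>z\<in>vdom y. \<exists>v\<in>M. w = opair z v}"
          using z opair_mem_in_M(2)[OF _ f] by auto
      qed (use 1(1) in auto)
      with v show ?case by (simp add: restr_def F[of y])
    qed
    have "elts f = ?p ` vdom f"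
    proof (intro set_eqI iffI)
      fix w assume "w \<in> elts f"
      with good obtain y v where "w = opair y v" unfolding good_def by blast
      with \<open>w \<in> elts f\<close> val show "w \<in> ?p ` vdom f" by (auto simp: vdom_def)
    next
      fix w assume "w \<in> ?p ` vdom f"
      then show "w \<in> elts f" using val by (auto simp: vdom_def)
    qed
    moreover have "vdom y \<subseteq> vdom f" if "y \<in> vdom f" for y
    proof -
      from that obtain v where "opair y v \<in> elts f" by (auto simp: vdom_def)
      with good show ?thesis unfolding good_def by fastforce
    qed
    ultimately show ?thesis by (simp add: approx_def)
  qed

  have least_unique: "f = g" if "f \<in> M" "g \<in> M" "least y f" "least y g" for f g y
  proof -
    have "elts f = elts g" using that unfolding least_def by blast
    then show ?thesis by (simp add: elts_inject)
  qed
  have G_eq: "G y = f" if "f \<in> M" "least y f" for y f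
  proof -
    have "(THE f. f \<in> M \<and> least y f) = f"
      using that least_unique by (intro the_equality) blast+
    then show ?thesis using that by (auto simp: G_def)
  qed
  have G_iff: "f = G y \<longleftrightarrow> least y f \<or> ((\<forall>g\<in>M. \<not> least y g) \<and> f = y)" if "f \<in> M" for f y
  proof (cases "\<exists>g\<in>M. least y g")
    case True
    then obtain g where "g \<in> M" "least y g" by blast
    then show ?thesis using G_eq[of g y] least_unique[OF that] by auto
  next
    case False
    then show ?thesis using that by (auto simp: G_def)
  qed
  have G_definable_term: "definable_term M (\<lambda>\<rho>. G (t \<rho>))" if t: "definable_term M t" for t
    unfolding definable_term_def
  proof (intro conjI allI impI)
    fix \<rho> :: "nat \<Rightarrow> hc" assume "\<forall>i. \<rho> i \<in> M"
    then have "t \<rho> \<in> M" by (rule definable_term_closed[OF t])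
    then show "G (t \<rho>) \<in> M"
      using G_eq by (metis G_def)
  next
    have "definable M (\<lambda>\<rho>. least (t (\<lambda>n. \<rho> (Suc n))) (\<rho> 0) \<or>
        ((\<forall>g\<in>M. \<not> least (t (\<lambda>n. \<rho> (Suc n))) g) \<and> \<rho> 0 = t (\<lambda>n. \<rho> (Suc n))))"
      by (intro definable_or definable_and definable_all definable_neg
        definable_eq least_definable definable_term_var t[THEN definable_term_rename])
    then show "definable M (\<lambda>\<rho>. \<rho> 0 = G (t (\<lambda>n. \<rho> (Suc n))))"
      by (rule definable_cong) (simp add: G_iff)
  qed

  have "\<exists>f\<in>M. least y f" if "y \<in> M" for y
    using that
  proof (induction y rule: vdom_induct)
    case (1 y)
    have G: "G z \<in> M" "least z (G z)" if "z \<in> vdom y" for z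
      using 1(1)[OF that vdom_in_M[OF that 1(2)]] G_eq by auto
    have G_approx: "approx (G z) (vdom (G z))" if "z \<in> vdom y" for z
      using G[OF that] approx_if_good unfolding least_def by blast
    \<comment> \<open>All \<open>G z\<close> are pieces of the graph of \<open>F\<close>, so they
      cannot conflict, and their union is an approximation whose domain includes
      \<open>vdom y\<close>. Only the pair for \<open>y\<close> is still missing.\<close>
    define U where "U = mk (\<Union>z\<in>vdom y. elts (G z))"
    define D where "D = (\<Union>z\<in>vdom y. vdom (G z))"
    have "definable_term M (\<lambda>_. U)"
      unfolding U_def
      by (rule definable_term_UN_vdom, rule definable_term_const, rule 1(2), rule G_definable_term, rule definable_term_var)
    then have U: "U \<in> M"
      by (rule definable_term_closed[where \<rho> = "\<lambda>_. y"]) (simp add: 1(2))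
    have elts_U: "elts U = (\<Union>z\<in>vdom y. elts (G z))"
      unfolding U_def by (rule elts_mk) simp
    have UD: "approx U D"
      unfolding approx_def elts_U D_def using G_approx[unfolded approx_def] by blast
    have sub: "vdom y \<subseteq> D"
      using G(2) unfolding least_def D_def by blast
    have "restr U y \<in> M"
      using definable_term_closed[OF restr_definable_term[OF definable_term_const definable_term_const],
          OF U \<open>y \<in> M\<close>, where \<rho> = "\<lambda>_. y"] \<open>y \<in> M\<close>
      by simp
    then have "mk (?p ` vdom y) \<in> M"
      by (simp add: restr_approx[OF U UD sub])
    then have "F y \<in> M"
      using definable_term_closed[OF H[OF definable_term_const definable_term_const],
          OF \<open>y \<in> M\<close>, where \<rho> = "\<lambda>_. y"] \<open>y \<in> M\<close> F[of y]
      by simp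
    then have "mk {?p y, ?p y} \<in> M"
      using pair_in_M opair_in_M \<open>y \<in> M\<close> by blast
    define f where "f = mk (elts U \<union> elts (mk {?p y, ?p y}))"
    have f: "f \<in> M"
      unfolding f_def by (rule Un_in_M[OF U \<open>mk {?p y, ?p y} \<in> M\<close>])
    have elts_f: "elts f = insert (?p y) (elts U)" unfolding f_def by simp
    have fD: "approx f (insert y D)"
      using UD sub unfolding approx_def elts_f by auto
    have "least y f"
      unfolding least_def
    proof (intro conjI ballI impI)
      show "good f" by (rule good_if_approx[OF f fD])
      show "y \<in> vdom f" by (simp add: vdom_approx[OF fD])
      fix g w assume g: "g \<in> M" "good g \<and> y \<in> vdom g" and w: "w \<in> elts f"
      then have gD: "approx g (vdom g)" using approx_if_good by blast
      \<comment> \<open>The domain of g is closed under \<open>vdom\<close>, so g competes with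
        every \<open>G z\<close> and contains it by leastness of \<open>G z\<close>.\<close>
      then have "z \<in> vdom g" if "z \<in> vdom y" for z
        using that g(2) unfolding approx_def by blast
      then have "elts U \<subseteq> elts g"
        using G(2) g unfolding least_def elts_U by blast
      moreover have "?p y \<in> elts g" using gD g(2) by (simp add: approx_def)
      ultimately show "w \<in> elts g" using w elts_f by auto
    qed
    with f show ?case by blast
  qed
  with \<open>x \<in> M\<close> obtain f where "f \<in> M" "least x f" by blast
  then have "opair x (F x) \<in> elts f"
    using approx_if_good unfolding least_def approx_def by blast
  then show ?thesis using opair_mem_in_M(2) \<open>f \<in> M\<close> by blast
qed

end

section \<open>Boolean values over the topology of a forcing poset\<close>

locale forcing =
  fixes P le one :: hc
  assumes poset: "forcing_poset P le one"
begin

abbreviation le_cond :: "hc \<Rightarrow> hc \<Rightarrow> bool" (infix "\<preceq>" 50) where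
  "q \<preceq> p \<equiv> lle le q p"

abbreviation T :: "hc topology" where
  "T \<equiv> ptop P le"

lemma le_refl: "p \<in> elts P \<Longrightarrow> p \<preceq> p"
  using poset unfolding forcing_poset_def by blast

lemma le_trans [trans]: "p \<preceq> q \<Longrightarrow> q \<preceq> r \<Longrightarrow> p \<preceq> r"
  using poset unfolding forcing_poset_def by blast

lemma le_in_P:
  assumes "q \<preceq> p"
  shows "q \<in> elts P" "p \<in> elts P"
  using assms poset unfolding forcing_poset_def lle_def by (metis opair_inject)+

lemma mem_down [simp]: "q \<in> down P le p \<longleftrightarrow> q \<preceq> p"
  unfolding down_def using le_in_P by blast

lemma dense_below_iff: "dense_below P le p D \<longleftrightarrow> (\<forall>q. q \<preceq> p \<longrightarrow> (\<exists>s. s \<preceq> q \<and> s \<in> D))"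
  unfolding dense_below_def by (auto simp: Ball_def Bex_def)

section \<open>Open and regular open sets in terms of conditions\<close>

lemma openin_T: "openin T U \<longleftrightarrow> U \<subseteq> elts P \<and> (\<forall>p\<in>U. \<forall>q. q \<preceq> p \<longrightarrow> q \<in> U)"
proof
  assume "openin T U"
  then have "generate_topology_on (down P le ` elts P) U"
    by (simp add: ptop_def openin_topology_generated_by_iff)
  then show "U \<subseteq> elts P \<and> (\<forall>p\<in>U. \<forall>q. q \<preceq> p \<longrightarrow> q \<in> U)"
  proof induction
    case (Basis s)
    then obtain p where "s = down P le p" by blast
    then show ?case using le_trans le_in_P by auto
  qed blast+
next
  assume U: "U \<subseteq> elts P \<and> (\<forall>p\<in>U. \<forall>q. q \<preceq> p \<longrightarrow> q \<in> U)"
  then have "U = (\<Union>p\<in>U. down P le p)"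
    using U le_refl by (simp add: set_eq_iff) blast
  moreover have "openin T (\<Union>p\<in>U. down P le p)"
    using U by (intro openin_Union) (auto simp: ptop_def intro!: topology_generated_by_Basis)
  ultimately show "openin T U" by simp
qed

lemma topspace_T [simp]: "topspace T = elts P"
proof -
  have "openin T (elts P)" using le_in_P by (auto simp: openin_T)
  then have "elts P \<subseteq> topspace T" by (rule openin_subset)
  moreover have "topspace T \<subseteq> elts P" using openin_topspace[of T] by (simp only: openin_T)
  ultimately show ?thesis by blast
qed

text \<open>The conditions below p form the least open set containing p, so being interior is tested
  on this set alone. Closures and regular open hulls thereby become statements about
  extensions.\<close>

lemma interior_T: "p \<in> T interior_of S \<longleftrightarrow> p \<in> elts P \<and> (\<forall>q. q \<preceq> p \<longrightarrow> q \<in> S)"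
proof
  assume p: "p \<in> elts P \<and> (\<forall>q. q \<preceq> p \<longrightarrow> q \<in> S)"
  have "openin T (down P le p)" using le_in_P le_trans by (auto simp: openin_T)
  with p show "p \<in> T interior_of S"
    unfolding interior_of_def using le_refl by (auto intro!: exI[of _ "down P le p"])
next
  assume "p \<in> T interior_of S"
  then show "p \<in> elts P \<and> (\<forall>q. q \<preceq> p \<longrightarrow> q \<in> S)"
    unfolding interior_of_def openin_T by blast
qed

lemma closure_T: "p \<in> T closure_of S \<longleftrightarrow> p \<in> elts P \<and> (\<exists>q. q \<preceq> p \<and> q \<in> S)"
proof -
  have "p \<in> T closure_of S \<longleftrightarrow> p \<in> elts P - T interior_of (elts P - S)"
    unfolding closure_of_interior_of by simp
  then show ?thesis by (auto simp: interior_T dest: le_in_P)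
qed

lemma mem_int_cl:
  "p \<in> T interior_of (T closure_of S) \<longleftrightarrow> p \<in> elts P \<and> (\<forall>q. q \<preceq> p \<longrightarrow> (\<exists>r. r \<preceq> q \<and> r \<in> S))"
  by (auto simp: interior_T closure_T dest: le_in_P)

lemma regular_open_T:
  "regular_open T U \<longleftrightarrow> (\<forall>p. p \<in> U \<longleftrightarrow> p \<in> elts P \<and> (\<forall>q. q \<preceq> p \<longrightarrow> (\<exists>r. r \<preceq> q \<and> r \<in> U)))"
  unfolding regular_open_def set_eq_iff mem_int_cl by blast

lemma openD: "openin T U \<Longrightarrow> p \<in> U \<Longrightarrow> q \<preceq> p \<Longrightarrow> q \<in> U"
  by (auto simp: openin_T)

lemma regular_openD: "regular_open T U \<Longrightarrow> p \<in> U \<Longrightarrow> q \<preceq> p \<Longrightarrow> q \<in> U"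
  using openD regular_open_openin by blast

lemma regular_open_in_P: "regular_open T U \<Longrightarrow> p \<in> U \<Longrightarrow> p \<in> elts P"
  by (drule regular_open_openin) (auto simp: openin_T)

text \<open>The working form of regularity: it is enough to find members densely below p.
  Memberships in Boolean values are proved repeatedly in this way.\<close>

lemma regular_openI:
  "regular_open T U \<Longrightarrow> p \<in> elts P \<Longrightarrow> (\<And>q. q \<preceq> p \<Longrightarrow> \<exists>r. r \<preceq> q \<and> r \<in> U) \<Longrightarrow> p \<in> U"
  using regular_open_T by blast

lemma mem_canon: "p \<in> canon P le q \<longleftrightarrow> p \<in> elts P \<and> (\<forall>p'. p' \<preceq> p \<longrightarrow> (\<exists>r. r \<preceq> p' \<and> r \<preceq> q))"
  unfolding canon_def mem_int_cl by simp

text \<open>The conditions below p are dense below every member of \<open>canon P le p\<close>, and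
  they belong to U as soon as p does; regularity of U does the rest.\<close>

lemma canon_subset_iff:
  assumes "regular_open T U" "p \<in> elts P"
  shows "canon P le p \<subseteq> U \<longleftrightarrow> p \<in> U"
proof
  assume "canon P le p \<subseteq> U"
  moreover have "p \<in> canon P le p"
    unfolding mem_canon using assms(2) le_refl le_in_P by blast
  ultimately show "p \<in> U" by blast
next
  assume p: "p \<in> U"
  show "canon P le p \<subseteq> U"
  proof
    fix q assume "q \<in> canon P le p"
    then have q: "q \<in> elts P" "\<And>q'. q' \<preceq> q \<Longrightarrow> \<exists>r. r \<preceq> q' \<and> r \<preceq> p"
      unfolding mem_canon by auto
    show "q \<in> U"
      by (rule regular_openI[OF assms(1) q(1)]) (use q(2) regular_openD[OF assms(1) p] in blast)
  qed
qed

lemma mem_ro_Sup: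
  "p \<in> ro_Sup T S \<longleftrightarrow> p \<in> elts P \<and> (\<forall>q. q \<preceq> p \<longrightarrow> (\<exists>r. r \<preceq> q \<and> (\<exists>U\<in>S. r \<in> U)))"
  unfolding ro_Sup_def mem_int_cl by simp

text \<open>In this topology any intersection of open sets is open, so the interior taken in
  \<open>ro_Inf\<close> removes nothing.\<close>

lemma mem_ro_Inf:
  assumes "\<And>U. U \<in> S \<Longrightarrow> regular_open T U"
  shows "p \<in> ro_Inf T S \<longleftrightarrow> p \<in> elts P \<and> (\<forall>U\<in>S. p \<in> U)"
proof
  assume "p \<in> ro_Inf T S"
  then show "p \<in> elts P \<and> (\<forall>U\<in>S. p \<in> U)"
    unfolding ro_Inf_def interior_T using le_refl by blast
next
  assume "p \<in> elts P \<and> (\<forall>U\<in>S. p \<in> U)"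
  then have p: "p \<in> elts P" "\<And>U. U \<in> S \<Longrightarrow> p \<in> U" by auto
  have "q \<in> U" if "q \<preceq> p" "U \<in> S" for q U
    by (rule regular_openD[OF assms[OF that(2)] p(2)[OF that(2)] that(1)])
  with p(1) show "p \<in> ro_Inf T S"
    unfolding ro_Inf_def interior_T by (auto dest: le_in_P)
qed

lemma mem_ro_compl: "p \<in> ro_compl T U \<longleftrightarrow> p \<in> elts P \<and> (\<forall>q. q \<preceq> p \<longrightarrow> q \<notin> U)"
  unfolding ro_compl_def interior_T by (auto dest: le_in_P)

lemma regular_open_ro_compl: "openin T U \<Longrightarrow> regular_open T (ro_compl T U)"
proof -
  assume U: "openin T U"
  have "p \<in> ro_compl T U" if p: "p \<in> elts P" "\<And>q. q \<preceq> p \<Longrightarrow> \<exists>r. r \<preceq> q \<and> r \<in> ro_compl T U" for p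
    unfolding mem_ro_compl
  proof (intro conjI allI impI notI p(1))
    fix q assume q: "q \<preceq> p" "q \<in> U"
    then obtain r where r: "r \<preceq> q" "r \<in> ro_compl T U" using p(2) by blast
    then have "r \<in> U" using openD[OF U q(2)] by blast
    with r(2) show False using le_refl by (auto simp: mem_ro_compl)
  qed
  moreover have "q \<in> ro_compl T U" if "p \<in> ro_compl T U" "q \<preceq> p" for p q
    using that le_trans le_in_P by (auto simp: mem_ro_compl)
  moreover have "p \<in> elts P" if "p \<in> ro_compl T U" for p
    using that by (simp add: mem_ro_compl)
  ultimately show ?thesis
    unfolding regular_open_T using le_refl le_in_P by meson
qed

lemma regular_open_Int: "regular_open T U \<Longrightarrow> regular_open T V \<Longrightarrow> regular_open T (U \<inter> V)"
proof -
  assume U: "regular_open T U" and V: "regular_open T V"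
  have "p \<in> U \<inter> V \<longleftrightarrow> p \<in> elts P \<and> (\<forall>q. q \<preceq> p \<longrightarrow> (\<exists>r. r \<preceq> q \<and> r \<in> U \<inter> V))" for p
  proof
    assume p: "p \<in> U \<inter> V"
    then have "q \<in> U \<inter> V" if "q \<preceq> p" for q
      using regular_openD[OF U _ that] regular_openD[OF V _ that] by blast
    then show "p \<in> elts P \<and> (\<forall>q. q \<preceq> p \<longrightarrow> (\<exists>r. r \<preceq> q \<and> r \<in> U \<inter> V))"
      using p regular_open_in_P[OF U] le_refl le_in_P(1) by (meson IntD1)
  next
    assume "p \<in> elts P \<and> (\<forall>q. q \<preceq> p \<longrightarrow> (\<exists>r. r \<preceq> q \<and> r \<in> U \<inter> V))"
    then show "p \<in> U \<inter> V"
      using regular_openI[OF U, of p] regular_openI[OF V, of p] by blast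
  qed
  then show ?thesis unfolding regular_open_T by blast
qed

text \<open>Below a condition in U nothing lies in \<open>ro_compl T U\<close>, so V is dense there
  and regularity applies. Conversely, a condition below p either has an extension in U, which then
  lies in V, or lies in the complement itself.\<close>

lemma mem_imp:
  assumes "openin T U" "regular_open T V"
  shows "p \<in> ro_Sup T {ro_compl T U, V} \<longleftrightarrow> p \<in> elts P \<and> (\<forall>q. q \<preceq> p \<longrightarrow> q \<in> U \<longrightarrow> q \<in> V)"
proof (intro iffI conjI allI impI)
  assume p: "p \<in> ro_Sup T {ro_compl T U, V}"
  then show "p \<in> elts P" by (simp add: mem_ro_Sup)
  fix q assume q: "q \<preceq> p" "q \<in> U"
  show "q \<in> V"
  proof (rule regular_openI[OF assms(2)])
    show "q \<in> elts P" using q le_in_P by blast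
    fix r assume r: "r \<preceq> q"
    then obtain s where s: "s \<preceq> r" "s \<in> ro_compl T U \<or> s \<in> V"
      using p q le_trans unfolding mem_ro_Sup by blast
    moreover have "s \<in> U" using openD[OF assms(1) q(2)] r s le_trans by blast
    ultimately show "\<exists>s. s \<preceq> r \<and> s \<in> V" using le_refl le_in_P unfolding mem_ro_compl by blast
  qed
next
  assume p: "p \<in> elts P \<and> (\<forall>q. q \<preceq> p \<longrightarrow> q \<in> U \<longrightarrow> q \<in> V)"
  show "p \<in> ro_Sup T {ro_compl T U, V}"
    unfolding mem_ro_Sup
  proof (intro conjI allI impI)
    fix q assume q: "q \<preceq> p"
    show "\<exists>r. r \<preceq> q \<and> (\<exists>W\<in>{ro_compl T U, V}. r \<in> W)"
    proof (cases "\<exists>r. r \<preceq> q \<and> r \<in> U")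
      case True
      then show ?thesis using p q le_trans by blast
    next
      case False
      then have "q \<in> ro_compl T U" using q le_in_P unfolding mem_ro_compl by blast
      then show ?thesis using le_refl le_in_P q by blast
    qed
  qed (use p in blast)
qed


section \<open>Boolean equality as a congruence\<close>

lemma mem_bmem:
  "p \<in> bmem T x y \<longleftrightarrow> p \<in> elts P \<and>
     (\<forall>q. q \<preceq> p \<longrightarrow> (\<exists>r. r \<preceq> q \<and> (\<exists>t\<in>vdom y. r \<in> beq T x t \<and> r \<in> elts (app y t))))"
  unfolding bmem.simps[of T x y] mem_ro_Sup by simp

lemma regular_open_bmem: "regular_open T (bmem T x y)"
  unfolding bmem.simps[of T x y] by (rule regular_open_ro_Sup)

lemma regular_open_bsub: "regular_open T (bsub T x y)"
  unfolding bsub.simps[of T x y] by (intro regular_open_ro_Inf) (auto intro: regular_open_ro_Sup)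

lemma regular_open_beq: "regular_open T (beq T x y)"
  unfolding beq.simps[of T x y] by (intro regular_open_Int regular_open_bsub)

lemma regular_open_bval: "regular_open T (bval M T \<phi> \<rho>)"
proof (induction \<phi> arbitrary: \<rho>)
  case (All k \<phi>)
  then show ?case by (auto intro!: regular_open_ro_Inf)
qed (simp_all add: regular_open_bmem regular_open_beq regular_open_ro_compl regular_open_openin
    regular_open_Int regular_open_ro_Sup)

text \<open>The elements of a Boolean-valued universe, without the requirement of belonging to a model.\<close>

inductive bname :: "hc \<Rightarrow> bool" where
  "is_fun u \<Longrightarrow> (\<And>b. b \<in> vran u \<Longrightarrow> regular_open T (elts b)) \<Longrightarrow>
    (\<And>t. t \<in> vdom u \<Longrightarrow> bname t) \<Longrightarrow> bname u"

lemma app_eq: "is_fun u \<Longrightarrow> opair t b \<in> elts u \<Longrightarrow> app u t = b"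
  unfolding is_fun_def app_def by blast

lemma bname_is_fun: "bname u \<Longrightarrow> is_fun u"
  by (auto elim: bname.cases)

lemma bname_vdom: "bname u \<Longrightarrow> t \<in> vdom u \<Longrightarrow> bname t"
  by (auto elim: bname.cases)

lemma bname_value:
  assumes "bname u" "t \<in> vdom u"
  shows "opair t (app u t) \<in> elts u" "regular_open T (elts (app u t))"
proof -
  obtain b where "opair t b \<in> elts u" using assms(2) by (auto simp: vdom_def)
  moreover from this have "app u t = b" using assms(1) app_eq by (auto elim: bname.cases)
  ultimately show "opair t (app u t) \<in> elts u" by simp
  then have "app u t \<in> vran u" by (auto simp: vran_def)
  with assms(1) show "regular_open T (elts (app u t))" by cases blast
qed

lemma mem_bsub:
  assumes "bname x"
  shows "p \<in> bsub T x y \<longleftrightarrow> p \<in> elts P \<and>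
    (\<forall>t\<in>vdom x. \<forall>q. q \<preceq> p \<longrightarrow> q \<in> elts (app x t) \<longrightarrow> q \<in> bmem T t y)"
proof -
  have "p \<in> bsub T x y \<longleftrightarrow> p \<in> elts P \<and>
      (\<forall>t\<in>vdom x. p \<in> ro_Sup T {ro_compl T (elts (app x t)), bmem T t y})"
    unfolding bsub.simps[of T x y] by (subst mem_ro_Inf) (auto intro: regular_open_ro_Sup)
  also have "\<dots> \<longleftrightarrow> p \<in> elts P \<and>
      (\<forall>t\<in>vdom x. \<forall>q. q \<preceq> p \<longrightarrow> q \<in> elts (app x t) \<longrightarrow> q \<in> bmem T t y)"
    using mem_imp[OF regular_open_openin[OF bname_value(2)[OF assms]] regular_open_bmem] by auto
  finally show ?thesis .
qed

lemma mem_beq: "p \<in> beq T x y \<longleftrightarrow> p \<in> bsub T x y \<and> p \<in> bsub T y x"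
  by (simp add: beq.simps)

lemma beq_sym: "beq T x y = beq T y x"
  by (auto simp: mem_beq)

lemma bmem_if_value:
  assumes "p \<in> elts (app y t)" "regular_open T (elts (app y t))" "t \<in> vdom y" "p \<in> beq T x t"
  shows "p \<in> bmem T x y"
  unfolding mem_bmem
proof (intro conjI allI impI)
  show "p \<in> elts P" using assms regular_open_in_P by blast
  fix q assume "q \<preceq> p"
  with assms show "\<exists>r. r \<preceq> q \<and> (\<exists>t\<in>vdom y. r \<in> beq T x t \<and> r \<in> elts (app y t))"
    using regular_openD regular_open_beq le_refl le_in_P by meson
qed

lemma beq_refl: "bname x \<Longrightarrow> p \<in> elts P \<Longrightarrow> p \<in> beq T x x"
proof (induction x arbitrary: p rule: vdom_induct)
  case (1 x)
  have "q \<in> bmem T t x" if "t \<in> vdom x" "q \<in> elts (app x t)" for q t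
  proof (rule bmem_if_value[OF that(2) _ that(1)])
    show r: "regular_open T (elts (app x t))" using 1 that bname_value by blast
    show "q \<in> beq T t t" using 1 that bname_vdom regular_open_in_P[OF r] by blast
  qed
  then show ?case by (simp add: mem_beq mem_bsub 1)
qed

lemma beq_self: "bname x \<Longrightarrow> beq T x x = elts P"
  using beq_refl regular_open_in_P[OF regular_open_beq, of _ x x] by blast

text \<open>Induction on x alone covers both inclusions. \<open>step\<close> passes from an element
  of a through b to one of c; for the inclusion of z in x the roles of the ends are exchanged, and
  symmetry of \<open>beq\<close> brings the triple of elements back to one that starts in
  \<open>vdom x\<close>.\<close>

lemma beq_trans:
  "bname x \<Longrightarrow> bname y \<Longrightarrow> bname z \<Longrightarrow> p \<in> beq T x y \<Longrightarrow> p \<in> beq T y z \<Longrightarrow> p \<in> beq T x z"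
proof (induction x arbitrary: y z p rule: vdom_induct)
  case (1 x)
  have step: "q \<in> bmem T t c"
    if a: "bname a" "bname b" "bname c" and q: "q \<preceq> p" "t \<in> vdom a" "q \<in> elts (app a t)"
      and p: "p \<in> bsub T a b" "p \<in> bsub T b c"
      and tr: "\<And>s w r. s \<in> vdom b \<Longrightarrow> w \<in> vdom c \<Longrightarrow> r \<in> beq T t s \<Longrightarrow> r \<in> beq T s w \<Longrightarrow> r \<in> beq T t w"
    for a b c q t
  proof (rule regular_openI[OF regular_open_bmem])
    show "q \<in> elts P" using q le_in_P by blast
    fix q' assume q': "q' \<preceq> q"
    have "q \<in> bmem T t b" using p(1) q a by (simp add: mem_bsub)
    then obtain r s where r: "r \<preceq> q'" "s \<in> vdom b" "r \<in> beq T t s" "r \<in> elts (app b s)"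
      unfolding mem_bmem using q' by blast
    then have "r \<preceq> p" using q' q le_trans by blast
    then have "r \<in> bmem T s c" using p(2) r a by (simp add: mem_bsub)
    then obtain r' w where r': "r' \<preceq> r" "w \<in> vdom c" "r' \<in> beq T s w" "r' \<in> elts (app c w)"
      unfolding mem_bmem using le_refl[of r] by blast
    have "r' \<in> beq T t s" using regular_openD[OF regular_open_beq r(3) r'(1)] .
    then have "r' \<in> beq T t w" using tr r r' by blast
    then have "r' \<in> bmem T t c"
      using r' a bname_value by (intro bmem_if_value[OF r'(4) _ r'(2)]) blast+
    then show "\<exists>r. r \<preceq> q' \<and> r \<in> bmem T t c" using r' r le_trans by blast
  qed
  have "q \<in> bmem T t z" if "q \<preceq> p" "t \<in> vdom x" "q \<in> elts (app x t)" for q t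
  proof (rule step[OF 1(2,3,4) that])
    show "p \<in> bsub T x y" "p \<in> bsub T y z" using 1(5,6) by (simp_all add: mem_beq)
    fix s w r assume "s \<in> vdom y" "w \<in> vdom z" "r \<in> beq T t s" "r \<in> beq T s w"
    then show "r \<in> beq T t w"
      by (intro 1(1)[OF that(2), of s w r] bname_vdom[OF 1(2) that(2)] bname_vdom[OF 1(3)] bname_vdom[OF 1(4)])
  qed
  moreover have "q \<in> bmem T w x" if "q \<preceq> p" "w \<in> vdom z" "q \<in> elts (app z w)" for q w
  proof (rule step[OF 1(4,3,2) that])
    show "p \<in> bsub T z y" "p \<in> bsub T y x" using 1(5,6) by (simp_all add: mem_beq)
    fix s t r assume "s \<in> vdom y" "t \<in> vdom x" "r \<in> beq T w s" "r \<in> beq T s t"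
    then show "r \<in> beq T w t"
      unfolding beq_sym[of w] beq_sym[of s t]
      by (intro 1(1)[of
        t s w r] bname_vdom[OF 1(2)] bname_vdom[OF 1(3)] bname_vdom[OF 1(4) that(2)])
  qed
  moreover have "p \<in> elts P" using 1(5) regular_open_in_P regular_open_beq by blast
  ultimately show ?case by (simp add: mem_beq mem_bsub 1)
qed

lemma bmem_cong_left:
  assumes "bname x" "bname x'" "bname y" "p \<in> beq T x' x" "p \<in> bmem T x y"
  shows "p \<in> bmem T x' y"
  unfolding mem_bmem
proof (intro conjI allI impI)
  show "p \<in> elts P" using assms(5) by (simp add: mem_bmem)
  fix q assume q: "q \<preceq> p"
  then obtain r t where r: "r \<preceq> q" "t \<in> vdom y" "r \<in> beq T x t" "r \<in> elts (app y t)"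
    using assms(5) unfolding mem_bmem by blast
  have "r \<in> beq T x' x"
    by (rule regular_openD[OF regular_open_beq assms(4) le_trans[OF r(1) q]])
  then have "r \<in> beq T x' t"
    by (rule beq_trans[OF assms(2,1) bname_vdom[OF assms(3) r(2)] _ r(3)])
  with r show "\<exists>r. r \<preceq> q \<and> (\<exists>t\<in>vdom y. r \<in> beq T x' t \<and> r \<in> elts (app y t))" by blast
qed

lemma bmem_cong_right:
  assumes "bname x" "bname y" "bname y'" "p \<in> beq T y y'" "p \<in> bmem T x y"
  shows "p \<in> bmem T x y'"
proof (rule regular_openI[OF regular_open_bmem])
  show "p \<in> elts P" using assms(5) by (simp add: mem_bmem)
  fix q assume q: "q \<preceq> p"
  then obtain r t where r: "r \<preceq> q" "t \<in> vdom y" "r \<in> beq T x t" "r \<in> elts (app y t)"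
    using assms(5) unfolding mem_bmem by blast
  then have "r \<preceq> p" using q le_trans by blast
  then have "r \<in> bmem T t y'" using assms r by (simp add: mem_beq mem_bsub)
  then have "r \<in> bmem T x y'"
    by (rule bmem_cong_left[OF bname_vdom[OF assms(2) r(2)] assms(1,3) r(3)])
  with r show "\<exists>r. r \<preceq> q \<and> r \<in> bmem T x y'" by blast
qed

text \<open>At a quantifier both assignments receive the same x, so all that is needed of x is that
  it equals itself with full value. This holds for a \<open>bname\<close>, whence the first
  assumption.\<close>

lemma bval_cong:
  assumes "\<And>x. x \<in> VB M T \<Longrightarrow> bname x"
    and "\<And>k. k \<in> fv \<phi> \<Longrightarrow> bname (\<sigma> k) \<and> bname (\<tau> k) \<and> beq T (\<sigma> k) (\<tau> k) = elts P"
  shows "bval M T \<phi> \<sigma> = bval M T \<phi> \<tau>"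
  using assms(2)
proof (induction \<phi> arbitrary: \<sigma> \<tau>)
  case (Mem k l)
  then have b: "bname (\<sigma> k)" "bname (\<tau> k)" "bname (\<sigma> l)" "bname (\<tau> l)"
    and e: "beq T (\<sigma> k) (\<tau> k) = elts P" "beq T (\<sigma> l) (\<tau> l) = elts P" by auto
  have "bmem T x y \<subseteq> bmem T x' y'"
    if "bname x" "bname x'" "bname y" "bname y'" "beq T x x' = elts P" "beq T y y' = elts P" for x x' y y'
  proof
    fix p assume p: "p \<in> bmem T x y"
    then have "p \<in> elts P" by (simp add: mem_bmem)
    then have "p \<in> beq T x' x" "p \<in> beq T y y'" using that beq_sym by auto
    then show "p \<in> bmem T x' y'"
      using bmem_cong_left[OF that(1,2,3) _ p] bmem_cong_right[OF that(2,3,4)] by blast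
  qed
  from this[of "\<sigma> k" "\<tau> k" "\<sigma> l" "\<tau> l"] this[of "\<tau> k" "\<sigma> k" "\<tau> l" "\<sigma> l"] b e
  show ?case by (simp add: beq_sym subset_antisym)
next
  case (Eq k l)
  then have b: "bname (\<sigma> k)" "bname (\<tau> k)" "bname (\<sigma> l)" "bname (\<tau> l)"
    and e: "beq T (\<sigma> k) (\<tau> k) = elts P" "beq T (\<sigma> l) (\<tau> l) = elts P" by auto
  have "beq T x y \<subseteq> beq T x' y'"
    if "bname x" "bname x'" "bname y" "bname y'" "beq T x x' = elts P" "beq T y y' = elts P" for x x' y y'
  proof
    fix p assume p: "p \<in> beq T x y"
    then have "p \<in> elts P" by (rule regular_open_in_P[OF regular_open_beq])
    then have "p \<in> beq T x' x" "p \<in> beq T y y'" using that beq_sym by auto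
    then show "p \<in> beq T x' y'"
      using beq_trans[OF that(2,1,3) _ p] beq_trans[OF that(2,3,4)] by blast
  qed
  from this[of "\<sigma> k" "\<tau> k" "\<sigma> l" "\<tau> l"] this[of "\<tau> k" "\<sigma> k" "\<tau> l" "\<sigma> l"] b e
  show ?case by (simp add: beq_sym subset_antisym)
next
  case (All k \<phi>)
  have "bval M T \<phi> (\<sigma>(k := x)) = bval M T \<phi> (\<tau>(k := x))" if "x \<in> VB M T" for x
  proof (rule All.IH)
    have "beq T x x = elts P"
      by (rule beq_self[OF assms(1)[OF that]])
    then show "bname ((\<sigma>(k := x)) i) \<and> bname ((\<tau>(k := x)) i) \<and>
        beq T ((\<sigma>(k := x)) i) ((\<tau>(k := x)) i) = elts P" if "i \<in> fv \<phi>" for i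
      using All.prems[of i] that assms(1)[OF \<open>x \<in> VB M T\<close>] by auto
  qed
  then show ?case by simp
next
  case (Ex k \<phi>)
  have "bval M T \<phi> (\<sigma>(k := x)) = bval M T \<phi> (\<tau>(k := x))" if "x \<in> VB M T" for x
  proof (rule Ex.IH)
    have "beq T x x = elts P"
      by (rule beq_self[OF assms(1)[OF that]])
    then show "bname ((\<sigma>(k := x)) i) \<and> bname ((\<tau>(k := x)) i) \<and>
        beq T ((\<sigma>(k := x)) i) ((\<tau>(k := x)) i) = elts P" if "i \<in> fv \<phi>" for i
      using Ex.prems[of i] that assms(1)[OF \<open>x \<in> VB M T\<close>] by auto
  qed
  then show ?case by simp
next
  case (And \<phi> \<psi>)
  from And.IH[of \<sigma> \<tau>] And.prems show ?case by simp
next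
  case (Or \<phi> \<psi>)
  from Or.IH[of \<sigma> \<tau>] Or.prems show ?case by simp
next
  case (Imp \<phi> \<psi>)
  from Imp.IH[of \<sigma> \<tau>] Imp.prems show ?case by simp
next
  case (Iff \<phi> \<psi>)
  from Iff.IH[of \<sigma> \<tau>] Iff.prems show ?case by simp
next
  case (Neg \<phi>)
  from Neg.IH[of \<sigma> \<tau>] Neg.prems show ?case by simp
qed

end

section \<open>Translation of names\<close>

text \<open>A right inverse, up to Boolean equality, of the translation of names into the
  Boolean-valued universe.\<close>

function inv_name :: "hc \<Rightarrow> hc" where
  "inv_name u = mk (\<Union>t\<in>vdom u. opair (inv_name t) ` elts (fapp u t))"
  by auto
termination
  by (relation "mem_rel\<^sup>+") (auto simp: wf_mem_trancl vdom_mem)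

text \<open>The double successor makes \<open>vsucc (vrank t)\<close> an element of \<open>vrank u\<close> without an appeal to
  the linearity of the ordinals.\<close>

function vrank :: "hc \<Rightarrow> hc" where
  "vrank u = mk (\<Union>t\<in>vdom u. elts (vsucc (vsucc (vrank t))))"
  by auto
termination
  by (relation "mem_rel\<^sup>+") (auto simp: wf_mem_trancl vdom_mem)

declare inv_name.simps [simp del] vrank.simps [simp del]

lemma elts_inv_name: "elts (inv_name u) = (\<Union>t\<in>vdom u. opair (inv_name t) ` elts (fapp u t))"
  unfolding inv_name.simps[of u] by (rule elts_mk) simp

lemma elts_vrank: "elts (vrank u) = (\<Union>t\<in>vdom u. elts (vsucc (vsucc (vrank t))))"
  unfolding vrank.simps[of u] by (rule elts_mk) simp

lemma elts_vsucc: "elts (vsucc x) = insert x (elts x)"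
  by (simp add: vsucc_def)

section \<open>Ordinal ranks and monotonicity of the hierarchy\<close>

lemma is_ord_vsucc: "is_ord x \<Longrightarrow> is_ord (vsucc x)"
  unfolding is_ord_def elts_vsucc by blast

lemma is_ord_vrank: "is_ord (vrank u)"
proof (induction u rule: vdom_induct)
  case (1 u)
  then have "is_ord (vsucc (vsucc (vrank t)))" if "t \<in> vdom u" for t
    using is_ord_vsucc that by blast
  then show ?case unfolding is_ord_def elts_vrank by blast
qed

text \<open>The recursion makes sense for any set as index, so this is an induction over membership.
  If \<open>\<alpha>\<close> is not a successor, an x at a level \<open>\<beta>\<close> with
  \<open>\<beta> \<in> elts \<alpha>\<close> is by induction also at \<open>vsucc \<beta>\<close>;
  its domain then lies in level \<open>\<beta>\<close>, hence in level
  \<open>\<alpha>\<close>.\<close>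

lemma VB_level_subset_vsucc: "VB_level M T \<alpha> \<subseteq> VB_level M T (vsucc \<alpha>)"
proof (induction \<alpha> rule: wf_induct_rule[OF wf_mem_rel])
  case (1 \<alpha>)
  then have IH: "VB_level M T \<beta> \<subseteq> VB_level M T (vsucc \<beta>)" if "\<beta> \<in> elts \<alpha>" for \<beta>
    using that by (simp add: mem_rel_iff)
  show ?case
  proof (cases "\<exists>\<beta>. \<alpha> = vsucc \<beta>")
    case True
    then obtain \<beta> where \<beta>: "\<alpha> = vsucc \<beta>" by blast
    with IH[of \<beta>] show ?thesis by (auto simp: VB_level_succ mem_vsucc)
  next
    case False
    then have eq: "VB_level M T \<alpha> = (\<Union>\<beta>\<in>elts \<alpha>. VB_level M T \<beta>)"
      by (intro VB_level_limit) blast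
    show ?thesis
    proof
      fix x assume "x \<in> VB_level M T \<alpha>"
      then obtain \<beta> where \<beta>: "\<beta> \<in> elts \<alpha>" "x \<in> VB_level M T \<beta>" using eq by blast
      with IH have "x \<in> VB_level M T (vsucc \<beta>)" by blast
      moreover have "VB_level M T \<beta> \<subseteq> VB_level M T \<alpha>" using \<beta>(1) eq by blast
      ultimately show "x \<in> VB_level M T (vsucc \<alpha>)" unfolding VB_level_succ by blast
    qed
  qed
qed

lemma VB_level_mono: "\<beta> \<in> elts \<alpha> \<Longrightarrow> VB_level M T \<beta> \<subseteq> VB_level M T \<alpha>"
proof (induction \<alpha> rule: wf_induct_rule[OF wf_mem_rel])
  case (1 \<alpha>)
  show ?case
  proof (cases "\<exists>\<gamma>. \<alpha> = vsucc \<gamma>")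
    case True
    then obtain \<gamma> where \<gamma>: "\<alpha> = vsucc \<gamma>" by blast
    then have "\<beta> = \<gamma> \<or> \<beta> \<in> elts \<gamma>" using 1(2) by (simp add: elts_vsucc)
    then have "VB_level M T \<beta> \<subseteq> VB_level M T \<gamma>"
      using 1(1)[of \<gamma>] \<gamma> by (auto simp: mem_rel_iff mem_vsucc)
    then show ?thesis using VB_level_subset_vsucc \<gamma> by blast
  next
    case False
    then show ?thesis using 1(2) VB_level_limit[of \<alpha> M T] by blast
  qed
qed

section \<open>The composite translation e\<close>

context forcing
begin

definition tr :: "hc \<Rightarrow> hc" where
  "tr x = retr T (i_star P le x)"

definition tr_value :: "hc \<Rightarrow> hc \<Rightarrow> hc set" where
  "tr_value x s = ro_Sup T {canon P le q |q. \<exists>z. opair z q \<in> elts x \<and> tr z = s}"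

text \<open>The conditions below c are contained in \<open>canon P le c\<close> and dense in it, so
  inside a join they may take its place.\<close>

lemma mem_tr_value:
  "p \<in> tr_value x s \<longleftrightarrow> p \<in> elts P \<and> (\<forall>q. q \<preceq> p \<longrightarrow>
     (\<exists>r. r \<preceq> q \<and> (\<exists>z c. opair z c \<in> elts x \<and> tr z = s \<and> r \<preceq> c)))"
proof -
  have 1: "r \<in> canon P le c" if "r \<preceq> c" for r c
    unfolding mem_canon using that le_in_P le_refl le_trans by meson
  have 2: "\<exists>s. s \<preceq> r \<and> s \<preceq> c" if "r \<in> canon P le c" for r c
    using that le_refl unfolding mem_canon by blast
  show ?thesis
    unfolding tr_value_def mem_ro_Sup
  proof (intro conj_cong refl all_cong imp_cong iffI)
    fix q assume "\<exists>r. r \<preceq> q \<and> (\<exists>U\<in>{canon P le q |q. \<exists>z. opair z q \<in> elts x \<and> tr z = s}. r \<in> U)"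
    then obtain r z c where r: "r \<preceq> q" "opair z c \<in> elts x" "tr z = s" "r \<in> canon P le c" by blast
    then obtain r' where "r' \<preceq> r" "r' \<preceq> c" using 2 by blast
    then show "\<exists>r. r \<preceq> q \<and> (\<exists>z c. opair z c \<in> elts x \<and> tr z = s \<and> r \<preceq> c)"
      using r le_trans[OF _ r(1)] by blast
  next
    fix q assume "\<exists>r. r \<preceq> q \<and> (\<exists>z c. opair z c \<in> elts x \<and> tr z = s \<and> r \<preceq> c)"
    then show "\<exists>r. r \<preceq> q \<and> (\<exists>U\<in>{canon P le q |q. \<exists>z. opair z q \<in> elts x \<and> tr z = s}. r \<in> U)"
      using 1 by blast
  qed
qed

lemma regular_open_tr_value: "regular_open T (tr_value x s)"
  unfolding tr_value_def by (rule regular_open_ro_Sup)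

lemma elts_mk_tr_value [simp]: "elts (mk (tr_value x s)) = tr_value x s"
  by (rule elts_mk, rule countable_subset[OF _ countable_elts[of P]]) (auto simp: mem_tr_value)

lemma elts_mk_canon [simp]: "elts (mk (canon P le q)) = canon P le q"
  by (rule elts_mk, rule countable_subset[OF _ countable_elts[of P]]) (auto simp: mem_canon)

lemma opair_mem_i_star:
  "opair a b \<in> elts (i_star P le x) \<longleftrightarrow>
    (\<exists>y q. opair y q \<in> elts x \<and> a = i_star P le y \<and> b = mk (canon P le q))"
proof -
  let ?W = "{w. \<exists>y\<in>vdom x. \<exists>q. opair y q \<in> elts x \<and> w = opair (i_star P le y) (mk (canon P le q))}"
  have "?W = (\<Union>y\<in>vdom x. (\<lambda>q. opair (i_star P le y) (mk (canon P le q))) ` {q. opair y q \<in> elts x})"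
    by auto
  then have "countable ?W" by simp
  then have "elts (i_star P le x) = ?W"
    unfolding i_star.simps[of P le x] by (rule elts_mk)
  then show ?thesis by (auto simp: vdom_def)
qed

lemma vdom_i_star: "vdom (i_star P le x) = i_star P le ` vdom x"
  unfolding vdom_def opair_mem_i_star by blast

text \<open>The two recursions are fused into one on P-names, and the intermediate name
  \<open>i_star P le x\<close> disappears. It is this single recursion that is carried out in M, so
  membership of the intermediate name in M does not have to be shown.\<close>

lemma tr_eq: "tr x = mk ((\<lambda>y. opair (tr y) (mk (tr_value x (tr y)))) ` vdom x)"
proof -
  have "{elts p |p. \<exists>z\<in>vdom (i_star P le x). opair z p \<in> elts (i_star P le x) \<and> retr T z = s} =
      {canon P le q |q. \<exists>z. opair z q \<in> elts x \<and> tr z = s}" for s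
  proof (intro set_eqI iffI)
    fix U
    assume "U \<in> {elts p |p. \<exists>z\<in>vdom (i_star P le x). opair z p \<in> elts (i_star P le x) \<and> retr T z = s}"
    then show "U \<in> {canon P le q |q. \<exists>z. opair z q \<in> elts x \<and> tr z = s}"
      unfolding opair_mem_i_star tr_def by auto
  next
    fix U assume "U \<in> {canon P le q |q. \<exists>z. opair z q \<in> elts x \<and> tr z = s}"
    then obtain q z where q: "U = canon P le q" "opair z q \<in> elts x" "tr z = s" by blast
    then have "opair (i_star P le z) (mk (canon P le q)) \<in> elts (i_star P le x)"
      unfolding opair_mem_i_star by blast
    moreover from this have "i_star P le z \<in> vdom (i_star P le x)" by (auto simp: vdom_def)
    moreover have "U = elts (mk (canon P le q))" using q by simp
    ultimately show "U \<in> {elts p |p. \<exists>z\<in>vdom (i_star P le x).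
        opair z p \<in> elts (i_star P le x) \<and> retr T z = s}"
      using q(3) unfolding tr_def by blast
  qed
  then have "ro_Sup T {elts p |p. \<exists>z\<in>vdom (i_star P le x). opair z p \<in> elts (i_star P le x) \<and> retr T z = s} =
      tr_value x s" for s
    by (simp add: tr_value_def)
  then show ?thesis
    unfolding tr_def[of x] retr.simps[of T "i_star P le x"] by (simp add: vdom_i_star image_image tr_def)
qed

lemma elts_tr: "elts (tr x) = (\<lambda>y. opair (tr y) (mk (tr_value x (tr y)))) ` vdom x"
  unfolding tr_eq[of x] by (rule elts_mk) simp

lemma vdom_tr: "vdom (tr x) = tr ` vdom x"
  by (auto simp: vdom_def[of "tr x"] elts_tr)

lemma bname_tr: "bname (tr x)"
proof (induction x rule: vdom_induct)
  case (1 x)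
  show ?case
  proof (rule bname.intros)
    show "is_fun (tr x)" unfolding is_fun_def elts_tr by auto
    show "regular_open T (elts b)" if "b \<in> vran (tr x)" for b
      using that regular_open_tr_value by (auto simp: vran_def elts_tr)
    show "bname t" if "t \<in> vdom (tr x)" for t
      using that 1 by (auto simp: vdom_tr)
  qed
qed

lemma app_tr: "y \<in> vdom x \<Longrightarrow> elts (app (tr x) (tr y)) = tr_value x (tr y)"
  by (subst app_eq[where b = "mk (tr_value x (tr y))"])
    (auto simp: elts_tr bname_tr bname_is_fun)

text \<open>A condition in the value at \<open>tr z\<close> has an extension below some c paired
  with a name z' that may differ from z. As \<open>tr z' = tr z\<close>, the Boolean equality with
  \<open>u\<close> carries over to z', so the merging of names by r does no damage.\<close>

lemma mem_bmem_tr: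
  "p \<in> bmem T u (tr y) \<longleftrightarrow> p \<in> elts P \<and>
     (\<forall>q. q \<preceq> p \<longrightarrow> (\<exists>r. r \<preceq> q \<and> (\<exists>z c. opair z c \<in> elts y \<and> r \<preceq> c \<and> r \<in> beq T u (tr z))))"
  unfolding mem_bmem
proof (intro conj_cong refl all_cong imp_cong iffI)
  fix q assume "\<exists>r. r \<preceq> q \<and> (\<exists>t\<in>vdom (tr y). r \<in> beq T u t \<and> r \<in> elts (app (tr y) t))"
  then obtain r z where r: "r \<preceq> q" "r \<in> beq T u (tr z)" "r \<in> tr_value y (tr z)"
    by (auto simp: vdom_tr app_tr)
  have "r \<preceq> r" by (rule le_refl[OF le_in_P(1)[OF r(1)]])
  with r(3) obtain s z' c where s: "s \<preceq> r" "opair z' c \<in> elts y" "tr z' = tr z" "s \<preceq> c"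
    unfolding mem_tr_value by blast
  have "s \<in> beq T u (tr z')"
    unfolding s(3) by (rule regular_openD[OF regular_open_beq r(2) s(1)])
  with s show "\<exists>r. r \<preceq> q \<and> (\<exists>z c. opair z c \<in> elts y \<and> r \<preceq> c \<and> r \<in> beq T u (tr z))"
    using le_trans[OF s(1) r(1)] by blast
next
  fix q assume "\<exists>r. r \<preceq> q \<and> (\<exists>z c. opair z c \<in> elts y \<and> r \<preceq> c \<and> r \<in> beq T u (tr z))"
  then obtain r z c where r: "r \<preceq> q" "opair z c \<in> elts y" "r \<preceq> c" "r \<in> beq T u (tr z)" by blast
  then have z: "z \<in> vdom y" by (auto simp: vdom_def)
  have "r \<in> tr_value y (tr z)"
    unfolding mem_tr_value
  proof (intro conjI allI impI)
    show "r \<in> elts P" using r(1) le_in_P by blast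
    fix q' assume "q' \<preceq> r"
    then show "\<exists>r. r \<preceq> q' \<and> (\<exists>z' c. opair z' c \<in> elts y \<and> tr z' = tr z \<and> r \<preceq> c)"
      using r(2) le_trans[OF _ r(3)] le_refl[OF le_in_P(1)] by blast
  qed
  then show "\<exists>r. r \<preceq> q \<and> (\<exists>t\<in>vdom (tr y). r \<in> beq T u t \<and> r \<in> elts (app (tr y) t))"
    using r z by (auto simp: vdom_tr app_tr)
qed

text \<open>Equality enters as an assumption because inside the induction on pairs of names only the
  induction hypothesis can provide it. Given it, both sides are the same density statement.\<close>

lemma fmem_iff_bmem:
  assumes "p \<in> elts P" "\<And>z q. z \<in> vdom y \<Longrightarrow> q \<in> elts P \<Longrightarrow> feq P le q x z \<longleftrightarrow> q \<in> beq T (tr x) (tr z)"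
  shows "fmem P le p x y \<longleftrightarrow> p \<in> bmem T (tr x) (tr y)"
proof -
  have "(\<exists>z\<in>vdom y. \<exists>c. opair z c \<in> elts y \<and> s \<preceq> c \<and> feq P le s x z) \<longleftrightarrow>
      (\<exists>z c. opair z c \<in> elts y \<and> s \<preceq> c \<and> s \<in> beq T (tr x) (tr z))" for s
    using assms(2)[OF _ le_in_P(1)] unfolding vdom_def by blast
  then have "fmem P le p x y \<longleftrightarrow> (\<forall>q. q \<preceq> p \<longrightarrow> (\<exists>s. s \<preceq> q \<and> s \<preceq> p \<and>
      (\<exists>z c. opair z c \<in> elts y \<and> s \<preceq> c \<and> s \<in> beq T (tr x) (tr z))))"
    unfolding fmem.simps[of P le p x y] dense_below_iff by simp
  also have "\<dots> \<longleftrightarrow> (\<forall>q. q \<preceq> p \<longrightarrow> (\<exists>s. s \<preceq> q \<and>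
      (\<exists>z c. opair z c \<in> elts y \<and> s \<preceq> c \<and> s \<in> beq T (tr x) (tr z))))"
    using le_trans[of _ _ p] by blast
  finally show ?thesis unfolding mem_bmem_tr using assms(1) by blast
qed

text \<open>Unfolding equality and then membership leads to pairs whose components both come from
  \<open>vdom x \<union> vdom y\<close>, possibly from the same name. Componentwise descent fails
  for such pairs; the multiset order allows it, since each new component is below x or y.\<close>

lemma feq_iff_beq: "p \<in> elts P \<Longrightarrow> feq P le p x y \<longleftrightarrow> p \<in> beq T (tr x) (tr y)"
proof -
  have wf: "wf (inv_image (mult (mem_rel\<^sup>+)) (\<lambda>(x, y). {#x, y#}))"
    by (intro wf_inv_image wf_mult wf_mem_trancl)
  show "p \<in> elts P \<Longrightarrow> feq P le p x y \<longleftrightarrow> p \<in> beq T (tr x) (tr y)"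
  proof (induction "(x, y)" arbitrary: x y p rule: wf_induct_rule[OF wf])
    case 1
    have IH: "feq P le q z z' \<longleftrightarrow> q \<in> beq T (tr z) (tr z')"
      if "z \<in> vdom x \<union> vdom y" "z' \<in> vdom x \<union> vdom y" "q \<in> elts P" for z z' q
    proof (rule 1(1)[OF _ that(3)])
      have "({#} + {#z, z'#}, {#} + {#x, y#}) \<in> mult (mem_rel\<^sup>+)"
        by (intro one_step_implies_mult) (use that vdom_mem in auto)
      then show "((z, z'), x, y) \<in> inv_image (mult (mem_rel\<^sup>+)) (\<lambda>(x, y). {#x, y#})"
        by simp
    qed
    have fx: "fmem P le q z x \<longleftrightarrow> q \<in> bmem T (tr z) (tr x)"
      and fy: "fmem P le q z y \<longleftrightarrow> q \<in> bmem T (tr z) (tr y)"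
      if "z \<in> vdom x \<union> vdom y" "q \<in> elts P" for z q
      using that IH by (intro fmem_iff_bmem; blast)+
    have "feq P le p x y \<longleftrightarrow> (\<forall>z\<in>vdom x \<union> vdom y. \<forall>q. q \<preceq> p \<longrightarrow>
        (q \<in> bmem T (tr z) (tr x) \<longleftrightarrow> q \<in> bmem T (tr z) (tr y)))"
      unfolding feq.simps[of P le p x y] using fx fy le_in_P by (auto simp: Ball_def)
    also have "\<dots> \<longleftrightarrow> p \<in> beq T (tr x) (tr y)"
    proof
      assume *: "\<forall>z\<in>vdom x \<union> vdom y. \<forall>q. q \<preceq> p \<longrightarrow>
        (q \<in> bmem T (tr z) (tr x) \<longleftrightarrow> q \<in> bmem T (tr z) (tr y))"
      \<comment> \<open>The forcing clause compares memberships, whereas Boolean inclusion starts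
        from values of the name. A value entails membership because \<open>tr z\<close> equals
        itself.\<close>
      have val: "q \<in> bmem T (tr z) (tr v)" if "z \<in> vdom v" "q \<in> elts (app (tr v) (tr z))" for z v q
      proof (rule bmem_if_value[OF that(2)])
        show z: "tr z \<in> vdom (tr v)" using that by (auto simp: vdom_tr)
        show r: "regular_open T (elts (app (tr v) (tr z)))" by (rule bname_value(2)[OF bname_tr z])
        show "q \<in> beq T (tr z) (tr z)"
          by (rule beq_refl[OF bname_tr regular_open_in_P[OF r that(2)]])
      qed
      show "p \<in> beq T (tr x) (tr y)"
      proof -
        have "q \<in> bmem T (tr z) (tr y)" if "z \<in> vdom x" "q \<preceq> p" "q \<in> elts (app (tr x) (tr z))" for z q
          using * val[OF that(1,3)] that by blast
        moreover have "q \<in> bmem T (tr z) (tr x)" if "z \<in> vdom y" "q \<preceq> p" "q \<in> elts (app (tr y) (tr z))" for z q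
          using * val[OF that(1,3)] that by blast
        ultimately show ?thesis by (simp add: mem_beq mem_bsub bname_tr vdom_tr 1(2))
      qed
    next
      assume p: "p \<in> beq T (tr x) (tr y)"
      have "q \<in> bmem T (tr z) (tr x) \<longleftrightarrow> q \<in> bmem T (tr z) (tr y)" if "q \<preceq> p" for z q
      proof -
        have q: "q \<in> beq T (tr x) (tr y)" by (rule regular_openD[OF regular_open_beq p that])
        then have "q \<in> beq T (tr y) (tr x)" by (simp add: beq_sym)
        with q bmem_cong_right[OF bname_tr bname_tr bname_tr] show ?thesis by blast
      qed
      then show "\<forall>z\<in>vdom x \<union> vdom y. \<forall>q. q \<preceq> p \<longrightarrow>
        (q \<in> bmem T (tr z) (tr x) \<longleftrightarrow> q \<in> bmem T (tr z) (tr y))" by blast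
    qed
    finally show ?case .
  qed
qed

section \<open>The right inverse up to Boolean equality\<close>

lemma elts_fapp_bname: "bname u \<Longrightarrow> t \<in> vdom u \<Longrightarrow> elts (fapp u t) = elts (app u t)"
proof -
  assume u: "bname u" "t \<in> vdom u"
  have "{z. opair t z \<in> elts u} = {app u t}"
    using bname_value(1)[OF u] app_eq[OF bname_is_fun[OF u(1)]] by blast
  then show ?thesis by (simp add: elts_fapp)
qed

lemma opair_mem_inv_name:
  assumes "bname u"
  shows "opair a p \<in> elts (inv_name u) \<longleftrightarrow> (\<exists>t\<in>vdom u. a = inv_name t \<and> p \<in> elts (app u t))"
  unfolding elts_inv_name using elts_fapp_bname[OF assms] by auto

lemma name_inv_name: "bname u \<Longrightarrow> name (elts P) (inv_name u)"
proof (induction u rule: vdom_induct)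
  case (1 u)
  have "p \<in> elts P" if "t \<in> vdom u" "p \<in> elts (fapp u t)" for t p
    using regular_open_in_P[OF bname_value(2)[OF 1(2) that(1)]] that(2)
    by (simp add: elts_fapp_bname[OF 1(2) that(1)])
  moreover have "name (elts P) (inv_name t)" if "t \<in> vdom u" for t
    by (rule 1(1)[OF that bname_vdom[OF 1(2) that]])
  ultimately show ?case
    by (intro name.intros) (auto simp: elts_inv_name)
qed

text \<open>Elements of \<open>vdom u\<close> may be merged by the round trip, so the value at
  \<open>s\<close> is a join over several t. Densely below a condition in it, one such t is picked
  out together with some c in \<open>app u t\<close>, and \<open>s\<close> equals t by induction.
  Conversely, a condition q in \<open>app u t\<close> is itself paired with
  \<open>inv_name t\<close>, which gives membership at once.\<close>

lemma beq_tr_inv_name: "bname u \<Longrightarrow> beq T (tr (inv_name u)) u = elts P"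
proof (induction u rule: vdom_induct)
  case (1 u)
  have IH: "beq T (tr (inv_name t)) t = elts P" if "t \<in> vdom u" for t
    by (rule 1(1)[OF that bname_vdom[OF 1(2) that]])
  have "q \<in> bmem T s u" if s: "s \<in> vdom (tr (inv_name u))" "q \<in> elts (app (tr (inv_name u)) s)" for q s
  proof -
    obtain a where a: "a \<in> vdom (inv_name u)" "s = tr a" using s(1) by (auto simp: vdom_tr)
    then have q: "q \<in> tr_value (inv_name u) s" using s(2) by (simp add: app_tr)
    show ?thesis
    proof (rule regular_openI[OF regular_open_bmem])
      show "q \<in> elts P" using q by (simp add: mem_tr_value)
      fix q' assume "q' \<preceq> q"
      then obtain r z c where r: "r \<preceq> q'" "opair z c \<in> elts (inv_name u)" "tr z = s" "r \<preceq> c"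
        using q unfolding mem_tr_value by blast
      then obtain t where t: "t \<in> vdom u" "z = inv_name t" "c \<in> elts (app u t)"
        by (auto simp: opair_mem_inv_name[OF 1(2)])
      have ro: "regular_open T (elts (app u t))" by (rule bname_value(2)[OF 1(2) t(1)])
      have "r \<in> bmem T s u"
        by (rule bmem_if_value[OF regular_openD[OF ro t(3) r(4)] ro t(1)])
          (use IH[OF t(1)] r(3,4) t(2) le_in_P in auto)
      with r(1) show "\<exists>r. r \<preceq> q' \<and> r \<in> bmem T s u" by blast
    qed
  qed
  moreover have "q \<in> bmem T t (tr (inv_name u))" if t: "t \<in> vdom u" "q \<in> elts (app u t)" for q t
  proof -
    have q: "q \<in> elts P" using regular_open_in_P[OF bname_value(2)[OF 1(2) t(1)] t(2)] .
    have "opair (inv_name t) q \<in> elts (inv_name u)" using t by (auto simp: opair_mem_inv_name[OF 1(2)])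
    moreover have "r \<in> beq T t (tr (inv_name t))" if "r \<preceq> q" for r
      using IH[OF t(1)] that le_in_P by (simp add: beq_sym)
    ultimately show ?thesis
      unfolding mem_bmem_tr using q le_refl le_in_P by blast
  qed
  ultimately have "p \<in> beq T (tr (inv_name u)) u" if "p \<in> elts P" for p
    using that by (simp add: mem_beq mem_bsub bname_tr 1(2))
  then show ?case using regular_open_in_P[OF regular_open_beq] by blast
qed

end

section \<open>Forcing clauses as Boolean operations\<close>

context forcing
begin

lemma dense_below_iff_ro_Sup:
  assumes "p \<in> elts P" "\<And>q. q \<in> elts P \<Longrightarrow> Q q \<longleftrightarrow> (\<exists>U\<in>S. q \<in> U)"
  shows "dense_below P le p {q \<in> elts P. Q q} \<longleftrightarrow> p \<in> ro_Sup T S"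
  unfolding dense_below_iff mem_ro_Sup mem_Collect_eq using assms le_in_P(1) by blast

text \<open>The forcing clause gives each q in U only some extension in V. Applied to all extensions
  of q, which again lie in U, it makes V dense below q, and regularity puts q into V.\<close>

lemma mem_imp_dense:
  assumes "regular_open T U" "regular_open T V" "p \<in> elts P"
    and A: "\<And>q. q \<in> elts P \<Longrightarrow> A q \<longleftrightarrow> q \<in> U" and B: "\<And>q. q \<in> elts P \<Longrightarrow> B q \<longleftrightarrow> q \<in> V"
  shows "\<not> (\<exists>q\<in>down P le p. A q \<and> \<not> (\<exists>s\<in>down P le q. B s)) \<longleftrightarrow> p \<in> ro_Sup T {ro_compl T U, V}"
proof -
  have "\<not> (\<exists>q\<in>down P le p. A q \<and> \<not> (\<exists>s\<in>down P le q. B s)) \<longleftrightarrow>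
      (\<forall>q. q \<preceq> p \<longrightarrow> q \<in> U \<longrightarrow> (\<exists>s. s \<preceq> q \<and> s \<in> V))"
    using A[OF le_in_P(1)] B[OF le_in_P(1)] by (auto simp: Ball_def Bex_def)
  also have "\<dots> \<longleftrightarrow> (\<forall>q. q \<preceq> p \<longrightarrow> q \<in> U \<longrightarrow> q \<in> V)"
  proof (intro iffI allI impI)
    fix q assume *: "\<forall>q. q \<preceq> p \<longrightarrow> q \<in> U \<longrightarrow> (\<exists>s. s \<preceq> q \<and> s \<in> V)" and q: "q \<preceq> p" "q \<in> U"
    show "q \<in> V"
    proof (rule regular_openI[OF assms(2) le_in_P(1)[OF q(1)]])
      fix r assume "r \<preceq> q"
      then show "\<exists>s. s \<preceq> r \<and> s \<in> V"
        using * le_trans[OF _ q(1)] regular_openD[OF assms(1) q(2)] by blast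
    qed
  next
    fix q assume "\<forall>q. q \<preceq> p \<longrightarrow> q \<in> U \<longrightarrow> q \<in> V" and q: "q \<preceq> p" "q \<in> U"
    then show "\<exists>s. s \<preceq> q \<and> s \<in> V" using le_refl[OF le_in_P(1)[OF q(1)]] by blast
  qed
  finally show ?thesis
    using mem_imp[OF regular_open_openin[OF assms(1)] assms(2)] assms(3) by blast
qed

end

section \<open>Closure of the model under the translations\<close>

context transitive_model
begin

text \<open>\<open>H\<close> is the defining equation with each recursive call replaced by a lookup
  in the graph \<open>g\<close>. The inner image is wrapped in \<open>elts (mk ...)\<close> so that
  it fits the rule for indexed unions of definable terms.\<close>

lemma inv_name_in_M: "u \<in> M \<Longrightarrow> inv_name u \<in> M"
proof (rule recursion_in_M[where F = inv_name and
    H = "\<lambda>u g. mk (\<Union>t\<in>vdom u. elts (mk ((\<lambda>p. opair (fapp g t) p) ` elts (fapp u t))))"])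
  show "definable_term M (\<lambda>\<rho>. mk (\<Union>x\<in>vdom (t \<rho>). elts (mk (opair (fapp (s \<rho>) x) ` elts (fapp (t \<rho>) x)))))"
    if t: "definable_term M t" and s: "definable_term M s" for t s
    by (intro definable_term_UN_vdom definable_term_image definable_term_opair definable_term_fapp
        definable_term_var
        t t[THEN definable_term_rename] s[THEN definable_term_rename])
  show "inv_name u = mk (\<Union>t\<in>vdom u. elts (mk ((\<lambda>p. opair
      (fapp (mk ((\<lambda>y. opair y (inv_name y)) ` vdom u)) t) p) ` elts (fapp u t))))" for u
    by (subst inv_name.simps) (simp add: fapp_graph)
qed

lemma vrank_in_M: "u \<in> M \<Longrightarrow> vrank u \<in> M"
proof (rule recursion_in_M[where F = vrank and
    H = "\<lambda>u g. mk (\<Union>t\<in>vdom u. elts (vsucc (vsucc (fapp g t))))"])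
  show "definable_term M (\<lambda>\<rho>. mk (\<Union>x\<in>vdom (t \<rho>). elts (vsucc (vsucc (fapp (s \<rho>) x)))))"
    if t: "definable_term M t" and s: "definable_term M s" for t s
    by (intro definable_term_UN_vdom definable_term_vsucc definable_term_fapp definable_term_var t
        s[THEN definable_term_rename])
  show "vrank u = mk (\<Union>t\<in>vdom u. elts (vsucc (vsucc
      (fapp (mk ((\<lambda>y. opair y (vrank y)) ` vdom u)) t))))" for u
    by (subst vrank.simps) (simp add: fapp_graph)
qed

lemma vsucc_in_M: "x \<in> M \<Longrightarrow> vsucc x \<in> M"
  using Un_in_M[OF pair_in_M, of x x x] by (simp add: vsucc_def)

end

section \<open>Forcing over the model\<close>

locale forcing_model = transitive_model M + forcing P le one
  for M :: "hc set" and P le one :: hc +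
  assumes P_in_M: "P \<in> M" and le_in_M: "le \<in> M"
begin

text \<open>The bound is an element of M, as the rules for definable bounded quantifiers
  require.\<close>

lemma all_le_iff: "(\<forall>q. q \<preceq> p \<longrightarrow> Q q) \<longleftrightarrow> (\<forall>q\<in>elts P. q \<preceq> p \<longrightarrow> Q q)"
  using le_in_P(1) by blast

text \<open>The topology is an object of the metalogic, so the join in \<open>tr_value\<close> is
  replaced by its density description. There every quantifier is bounded by \<open>P\<close> or by
  \<open>vdom x\<close>, and \<open>P\<close> and \<open>le\<close> enter as constants from
  M.\<close>

lemma tr_in_M: "x \<in> M \<Longrightarrow> tr x \<in> M"
proof (rule recursion_in_M[where F = tr and
    H = "\<lambda>x g. mk ((\<lambda>y. opair (fapp g y) (mk {p \<in> elts P. \<forall>q\<in>elts P. q \<preceq> p \<longrightarrow>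
     (\<exists>r\<in>elts P. r \<preceq> q \<and> (\<exists>z\<in>vdom x. \<exists>c\<in>elts P. opair z c \<in> elts x \<and> fapp g z = fapp g y \<and> r \<preceq> c))})) ` vdom x)"])
  show "definable_term M (\<lambda>\<rho>. mk ((\<lambda>y. opair (fapp (s \<rho>) y) (mk {p \<in> elts P. \<forall>q\<in>elts P. q \<preceq> p \<longrightarrow>
      (\<exists>r\<in>elts P. r \<preceq> q \<and> (\<exists>z\<in>vdom (t \<rho>). \<exists>c\<in>elts P. opair z c \<in> elts (t \<rho>) \<and>
        fapp (s \<rho>) z = fapp (s \<rho>) y \<and> r \<preceq> c))})) ` vdom (t \<rho>)))"
    if t: "definable_term M t" and s: "definable_term M s" for t s
    unfolding lle_def
    by (intro definable_term_image_vdom definable_term_opair definable_term_fapp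
        definable_term_Collect definable_ball definable_imp definable_bex definable_and
        definable_bex_vdom definable_mem definable_eq definable_term_var
        definable_term_const[OF P_in_M] definable_term_const[OF le_in_M]
        t t[THEN definable_term_rename] s[THEN definable_term_rename])
  fix x
  let ?g = "mk ((\<lambda>y. opair y (tr y)) ` vdom x)"
  have g: "fapp ?g y = tr y" if "y \<in> vdom x" for y
    using that by (simp add: fapp_graph)
  have "tr_value x (tr y) = {p \<in> elts P. \<forall>q\<in>elts P. q \<preceq> p \<longrightarrow> (\<exists>r\<in>elts P. r \<preceq> q \<and>
      (\<exists>z\<in>vdom x. \<exists>c\<in>elts P. opair z c \<in> elts x \<and> fapp ?g z = fapp ?g y \<and> r \<preceq> c))}"
    if "y \<in> vdom x" for y
  proof -
    have "(\<exists>r. r \<preceq> q \<and> (\<exists>z c. opair z c \<in> elts x \<and> tr z = tr y \<and> r \<preceq> c)) \<longleftrightarrow> (\<exists>r\<in>elts P. r \<preceq> q \<and>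
      (\<exists>z\<in>vdom x. \<exists>c\<in>elts P. opair z c \<in> elts x \<and> fapp ?g z = fapp ?g y \<and> r \<preceq> c))" for q
    proof
      assume "\<exists>r. r \<preceq> q \<and> (\<exists>z c. opair z c \<in> elts x \<and> tr z = tr y \<and> r \<preceq> c)"
      then obtain r z c where r: "r \<preceq> q" "opair z c \<in> elts x" "tr z = tr y" "r \<preceq> c" by blast
      have z: "z \<in> vdom x" using r(2) by (auto simp: vdom_def)
      have "fapp ?g z = fapp ?g y" using g[OF that] g[OF z] r(3) by simp
      with z show "\<exists>r\<in>elts P. r \<preceq> q \<and>
          (\<exists>z\<in>vdom x. \<exists>c\<in>elts P. opair z c \<in> elts x \<and> fapp ?g z = fapp ?g y \<and> r \<preceq> c)"
        using r le_in_P(1)[OF r(1)] le_in_P(2)[OF r(4)] by blast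
    next
      assume "\<exists>r\<in>elts P. r \<preceq> q \<and>
          (\<exists>z\<in>vdom x. \<exists>c\<in>elts P. opair z c \<in> elts x \<and> fapp ?g z = fapp ?g y \<and> r \<preceq> c)"
      then obtain r z c where r: "r \<preceq> q" "z \<in> vdom x" "opair z c \<in> elts x" "fapp ?g z = fapp ?g y" "r \<preceq> c"
        by blast
      then have "tr z = tr y" using g[OF that] g[OF r(2)] by simp
      with r show "\<exists>r. r \<preceq> q \<and> (\<exists>z c. opair z c \<in> elts x \<and> tr z = tr y \<and> r \<preceq> c)" by blast
    qed
    then show ?thesis
      by (intro set_eqI) (simp only: mem_tr_value mem_Collect_eq all_le_iff)
  qed
  then show "tr x = mk ((\<lambda>y. opair (fapp ?g y) (mk {p \<in> elts P. \<forall>q\<in>elts P. q \<preceq> p \<longrightarrow>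
      (\<exists>r\<in>elts P. r \<preceq> q \<and> (\<exists>z\<in>vdom x. \<exists>c\<in>elts P. opair z c \<in> elts x \<and>
        fapp ?g z = fapp ?g y \<and> r \<preceq> c))})) ` vdom x)"
    by (subst tr_eq) (intro arg_cong[where f = mk] image_cong refl, simp add: g)
qed

lemma bname_if_VB_level: "u \<in> VB_level M T \<alpha> \<Longrightarrow> u \<in> M \<and> bname u"
proof (induction \<alpha> arbitrary: u rule: wf_induct_rule[OF wf_mem_rel])
  case (1 \<alpha>)
  show ?case
  proof (cases "\<exists>\<beta>. \<alpha> = vsucc \<beta>")
    case True
    then obtain \<beta> where \<beta>: "\<alpha> = vsucc \<beta>" by blast
    with 1(2) have u: "u \<in> M" "is_fun u" "vdom u \<subseteq> VB_level M T \<beta>" "vran u \<subseteq> RO M T"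
      by (simp_all add: VB_level_succ)
    have "bname t" if "t \<in> vdom u" for t
      using 1(1)[of \<beta> t] \<beta> u(3) that by (auto simp: mem_rel_iff mem_vsucc)
    moreover have "regular_open T (elts b)" if "b \<in> vran u" for b
      using u(4) that by (auto simp: RO_def)
    ultimately have "bname u" using u(2) bname.intros by blast
    with u(1) show ?thesis by blast
  next
    case False
    with 1(2) obtain \<beta> where "\<beta> \<in> elts \<alpha>" "u \<in> VB_level M T \<beta>"
      using VB_level_limit[of \<alpha> M T] by blast
    then show ?thesis using 1(1) by (simp add: mem_rel_iff)
  qed
qed

lemma VB_level_vrank: "bname u \<Longrightarrow> u \<in> M \<Longrightarrow> u \<in> VB_level M T (vsucc (vrank u))"
proof (induction u rule: vdom_induct)
  case (1 u)
  have "t \<in> VB_level M T (vrank u)" if "t \<in> vdom u" for t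
  proof -
    have "t \<in> VB_level M T (vsucc (vrank t))"
      by (rule 1(1)[OF that bname_vdom[OF 1(2) that] vdom_in_M[OF that 1(3)]])
    moreover have "vsucc (vrank t) \<in> elts (vrank u)"
      using that mem_vsucc unfolding elts_vrank by blast
    ultimately show ?thesis using VB_level_mono by blast
  qed
  moreover have "b \<in> RO M T" if "b \<in> vran u" for b
  proof -
    obtain t where t: "opair t b \<in> elts u" using \<open>b \<in> vran u\<close> by (auto simp: vran_def)
    have "regular_open T (elts b)"
      using 1(2) that by cases blast
    then show ?thesis using opair_mem_in_M(2)[OF t 1(3)] by (simp add: RO_def)
  qed
  ultimately show ?case
    using 1(3) bname_is_fun[OF 1(2)] by (auto simp: VB_level_succ)
qed

text \<open>This identifies the hierarchy computed in M with a condition free of ordinals. The level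
  must be indexed by an ordinal of M, which is why \<open>vrank\<close> has to stay in M.\<close>

lemma mem_VB: "u \<in> VB M T \<longleftrightarrow> u \<in> M \<and> bname u"
proof
  show "u \<in> VB M T \<Longrightarrow> u \<in> M \<and> bname u"
    unfolding VB_def using bname_if_VB_level by blast
next
  assume u: "u \<in> M \<and> bname u"
  then have "vsucc (vrank u) \<in> {\<alpha> \<in> M. is_ord \<alpha>}"
    using vsucc_in_M vrank_in_M is_ord_vsucc is_ord_vrank by simp
  then show "u \<in> VB M T"
    unfolding VB_def using VB_level_vrank u by blast
qed

text \<open>The two sets of values are equal, not merely their bounds, so one lemma serves meets and
  joins alike. A given u is replaced by \<open>tr (inv_name u)\<close>; the other variables keep
  their values, and being a \<open>bname\<close> makes these equal to themselves with full
  value.\<close>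

lemma bval_names:
  assumes "\<And>i. i \<in> fv \<phi> - {k} \<Longrightarrow> bname (\<sigma> i)"
  shows "(\<lambda>u. bval M T \<phi> (\<sigma>(k := u))) ` VB M T = (\<lambda>x. bval M T \<phi> (\<sigma>(k := tr x))) ` names M (elts P)"
proof (intro equalityI subsetI; elim imageE)
  fix b x assume "b = bval M T \<phi> (\<sigma>(k := tr x))" "x \<in> names M (elts P)"
  then show "b \<in> (\<lambda>u. bval M T \<phi> (\<sigma>(k := u))) ` VB M T"
    using tr_in_M bname_tr by (auto simp: mem_VB names_def)
next
  fix b u assume b: "b = bval M T \<phi> (\<sigma>(k := u))" and "u \<in> VB M T"
  then have u: "u \<in> M" "bname u" by (simp_all add: mem_VB)
  then have "inv_name u \<in> names M (elts P)"
    by (simp add: names_def inv_name_in_M name_inv_name)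
  moreover have "bval M T \<phi> (\<sigma>(k := tr (inv_name u))) = b"
    unfolding b
    by (rule bval_cong) (use assms u in \<open>auto simp: mem_VB bname_tr beq_self beq_tr_inv_name\<close>)
  ultimately show "b \<in> (\<lambda>x. bval M T \<phi> (\<sigma>(k := tr x))) ` names M (elts P)" by blast
qed

text \<open>The condition p is generalized because the clauses evaluate subformulas at extensions.
  The assumption speaks of free variables only, so below a quantifier it passes to
  \<open>\<rho>(k := x)\<close> for every name x.\<close>

lemma forces_iff_bval:
  assumes "\<And>k. k \<in> fv \<phi> \<Longrightarrow> \<rho> k \<in> names M (elts P)" "p \<in> elts P"
  shows "forces M P le \<phi> \<rho> p \<longleftrightarrow> p \<in> bval M T \<phi> (\<lambda>k. tr (\<rho> k))"
  using assms
proof (induction \<phi> arbitrary: \<rho> p)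
  case (Mem k l)
  then show ?case by (simp add: fmem_iff_bmem feq_iff_beq)
next
  case (Eq k l)
  then show ?case by (simp add: feq_iff_beq)
next
  case (Neg \<phi>)
  then have IH: "forces M P le \<phi> \<rho> q \<longleftrightarrow> q \<in> bval M T \<phi> (\<lambda>k. tr (\<rho> k))" if "q \<preceq> p" for q
    using le_in_P(1)[OF that] by simp
  show ?case using IH Neg.prems(2) by (auto simp: mem_ro_compl)
next
  case (And \<phi> \<psi>)
  then show ?case by simp
next
  case (Or \<phi> \<psi>)
  then have IH: "forces M P le \<phi> \<rho> q \<longleftrightarrow> q \<in> bval M T \<phi> (\<lambda>k. tr (\<rho> k))"
    "forces M P le \<psi> \<rho> q \<longleftrightarrow> q \<in> bval M T \<psi> (\<lambda>k. tr (\<rho> k))" if "q \<in> elts P" for q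
    using that by simp_all
  show ?case
    unfolding bval.simps forces.simps
    by (rule dense_below_iff_ro_Sup[OF Or.prems(2)]) (simp add: IH)
next
  case (Imp \<phi> \<psi>)
  then have IH: "forces M P le \<phi> \<rho> q \<longleftrightarrow> q \<in> bval M T \<phi> (\<lambda>k. tr (\<rho> k))"
    "forces M P le \<psi> \<rho> q \<longleftrightarrow> q \<in> bval M T \<psi> (\<lambda>k. tr (\<rho> k))" if "q \<in> elts P" for q
    using that by simp_all
  show ?case
    by (simp only: forces.simps bval.simps mem_imp_dense[OF regular_open_bval regular_open_bval Imp.prems(2) IH])
next
  case (Iff \<phi> \<psi>)
  then have IH: "forces M P le \<phi> \<rho> q \<longleftrightarrow> q \<in> bval M T \<phi> (\<lambda>k. tr (\<rho> k))"
    "forces M P le \<psi> \<rho> q \<longleftrightarrow> q \<in> bval M T \<psi> (\<lambda>k. tr (\<rho> k))" if "q \<in> elts P" for q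
    using that by simp_all
  have "(\<exists>q\<in>down P le p. \<not> (\<exists>s\<in>down P le q. forces M P le \<phi> \<rho> s) \<and> forces M P le \<psi> \<rho> q) \<longleftrightarrow>
      (\<exists>q\<in>down P le p. forces M P le \<psi> \<rho> q \<and> \<not> (\<exists>s\<in>down P le q. forces M P le \<phi> \<rho> s))"
    by (simp only: conj_commute)
  then show ?case
    by (simp only: forces.simps bval.simps Int_iff
        mem_imp_dense[OF regular_open_bval regular_open_bval Iff.prems(2) IH]
        mem_imp_dense[OF regular_open_bval regular_open_bval Iff.prems(2) IH(2,1)])
next
  case (All k \<phi>)
  have "forces M P le (fm.All k \<phi>) \<rho> p \<longleftrightarrow>
      (\<forall>x\<in>names M (elts P). p \<in> bval M T \<phi> ((\<lambda>k. tr (\<rho> k))(k := tr x)))"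
  proof -
    have "forces M P le \<phi> (\<rho>(k := x)) p \<longleftrightarrow> p \<in> bval M T \<phi> ((\<lambda>k. tr (\<rho> k))(k := tr x))"
      if "x \<in> names M (elts P)" for x
    proof -
      have "forces M P le \<phi> (\<rho>(k := x)) p \<longleftrightarrow> p \<in> bval M T \<phi> (\<lambda>i. tr ((\<rho>(k := x)) i))"
        by (rule All.IH) (use All.prems that \<open>p \<in> elts P\<close> in auto)
      moreover have "(\<lambda>i. tr ((\<rho>(k := x)) i)) = (\<lambda>k. tr (\<rho> k))(k := tr x)" by auto
      ultimately show ?thesis by (simp only:)
    qed
    then show ?thesis by simp
  qed
  also have "\<dots> \<longleftrightarrow> (\<forall>U\<in>(\<lambda>x. bval M T \<phi> ((\<lambda>k. tr (\<rho> k))(k := tr x))) ` names M (elts P). p \<in> U)"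
    by simp
  also have "\<dots> \<longleftrightarrow> p \<in> bval M T (fm.All k \<phi>) (\<lambda>k. tr (\<rho> k))"
    unfolding bval_names[OF bname_tr, symmetric] bval.simps
    using All.prems(2) by (subst mem_ro_Inf) (auto simp: regular_open_bval)
  finally show ?case .
next
  case (Ex k \<phi>)
  have IH: "(\<exists>x\<in>names M (elts P). forces M P le \<phi> (\<rho>(k := x)) q) \<longleftrightarrow>
      (\<exists>U\<in>(\<lambda>x. bval M T \<phi> ((\<lambda>k. tr (\<rho> k))(k := tr x))) ` names M (elts P). q \<in> U)" if "q \<in> elts P" for q
  proof -
    have "forces M P le \<phi> (\<rho>(k := x)) q \<longleftrightarrow> q \<in> bval M T \<phi> ((\<lambda>k. tr (\<rho> k))(k := tr x))"
      if "x \<in> names M (elts P)" for x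
    proof -
      have "forces M P le \<phi> (\<rho>(k := x)) q \<longleftrightarrow> q \<in> bval M T \<phi> (\<lambda>i. tr ((\<rho>(k := x)) i))"
        by (rule Ex.IH) (use Ex.prems that \<open>q \<in> elts P\<close> in auto)
      moreover have "(\<lambda>i. tr ((\<rho>(k := x)) i)) = (\<lambda>k. tr (\<rho> k))(k := tr x)" by auto
      ultimately show ?thesis by (simp only:)
    qed
    then show ?thesis by simp
  qed
  show ?case
    unfolding bval.simps bval_names[OF bname_tr] forces.simps
    by (rule dense_below_iff_ro_Sup[OF Ex.prems(2) IH])
qed

end

theorem theorem2:
  fixes M :: "hc set" and P le one p :: hc and \<phi> :: fm and \<rho> :: "nat \<Rightarrow> hc"
  assumes "ctm_ZFC M"
    and "forcing_poset P le one"
    and "P \<in> M" and "le \<in> M" and "one \<in> M"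
    and "\<And>k. k \<in> fv \<phi> \<Longrightarrow> \<rho> k \<in> names M (elts P)"
    and "p \<in> elts P"
  shows "forces M P le \<phi> \<rho> p \<longleftrightarrow>
    canon P le p \<subseteq> bval M (ptop P le) \<phi> (\<lambda>k. retr (ptop P le) (i_star P le (\<rho> k)))"
proof -
  interpret forcing_model M P le one
    by unfold_locales (fact assms(1-4))+
  show ?thesis
    unfolding tr_def[symmetric]
    using forces_iff_bval[OF assms(6,7)] canon_subset_iff[OF regular_open_bval assms(7)] by simp
qed

end
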